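(* Let $\mathbb M=\mathbb K/\mathbb H$ be a compact connected Riemannian symmetric space with Riemannian distance $\partial_{\mathbb M}$ and $\mathbb K$-invariant probability measure $\sigma^{\mathbb M}$, where $\mathbb K$ is a compact connected semisimple Lie group, and let $\boldsymbol p_0\in\mathbb M$. For every nonempty finite subset $\mathcal S\subseteq\mathbb K$ of isometries of $\mathbb M$ and all integers $\ell\ge1$ and $q\ge0$, with $n=|\hat{\mathcal S}|^\ell$, $\mathscr S_\ell:=\hat{\mathcal S}^\ell\boldsymbol p_0$ and $\sigma^{\mathbb M}_\ell$ the empirical probability measure on $\mathscr S_\ell$, one has $$\frac1n\,d_{\operatorname{Pr}}\!\left(\Phi^{q,n}_{\mathbb M,\partial_{\mathbb M},\sigma^{\mathbb M}},\ \Phi^{q,n}_{\mathscr S_\ell,\partial_{\mathbb M},\sigma^{\mathbb M}_\ell}\right)\ \le\ W_1(\sigma^{\mathbb M},\sigma^{\mathbb M}_\ell)^{1/2}.$$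
   Context: $\mathbb K$ is a compact connected semisimple Lie group and $\mathbb H\subseteq\mathbb K$ a closed subgroup such that $\mathbb M=\mathbb K/\mathbb H$ is a compact connected Riemannian symmetric space; $\mathbb K$ acts transitively on $\mathbb M$ by isometries, written $(\boldsymbol s,\boldsymbol x)\mapsto\boldsymbol s\boldsymbol x$. $\hat{\mathcal S}=\mathcal S\sqcup\mathcal S^{-1}$ is the multiset of elements of $\mathcal S$ and their inverses; $\hat{\mathcal S}^\ell$ is the multiset of all $|\hat{\mathcal S}|^\ell$ products $\boldsymbol s_1\cdots\boldsymbol s_\ell$ with $\boldsymbol s_i\in\hat{\mathcal S}$; $\hat{\mathcal S}^\ell\boldsymbol p_0$ is the multiset of points $\boldsymbol s\boldsymbol p_0$, and $\sigma^{\mathbb M}_\ell=|\hat{\mathcal S}|^{-\ell}\sum_{\boldsymbol s\in\hat{\mathcal S}^\ell}\delta_{\boldsymbol s\boldsymbol p_0}$. $W_1$ is the 1-Wasserstein distance with respect to $\partial_{\mathbb M}$. Persistent homology: for a finite metric space (or finite tuple of points in a metric space) $Y$ and $x\ge0$, the Vietoris–Rips complex at scale $x$ has as simplices the finite subsets of $Y$ with all pairwise distances $<x$; $\operatorname{PH}_q(Y)$ is the barcode of the $q$-th persistent homology (with field coefficients) of this filtration, an element of the space $\mathcal B$ of barcodes equipped with the bottleneck distance $d_{\mathcal B}$. For a compact metric measure space $(X,d_X,\mu_X)$ with $\mu_X$ a probability measure, $\Phi^{q,n}_{X,d_X,\mu_X}:=(\operatorname{PH}_q)_\star(\mu_X^{\otimes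 n})$ is the law on $\mathcal B$ of the barcode $\operatorname{PH}_q$ of $n$ i.i.d. $\mu_X$-distributed points of $X$. $d_{\operatorname{Pr}}$ is the Prokhorov distance between probability measures on $(\mathcal B,d_{\mathcal B})$. *)

theory Defs
  imports "HOL-Probability.Probability" "HOL-Algebra.Group_Action"
begin

section \<open>Smooth manifolds, given by atlases on a topological type\<close>

primrec Ck_on :: "nat \<Rightarrow> 'a::real_normed_vector set \<Rightarrow> ('a \<Rightarrow> 'b::real_normed_vector) \<Rightarrow> bool" where
  "Ck_on 0 S f \<longleftrightarrow> continuous_on S f"
| "Ck_on (Suc k) S f \<longleftrightarrow> f differentiable_on S \<and>
     (\<forall>v. Ck_on k S (\<lambda>x. frechet_derivative f (at x) v))"

text \<open>Used only for open subsets of finite-dimensional spaces, where continuity of all iterated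
  directional derivatives is continuity of the iterated Frechet derivatives.\<close>

definition smooth_on :: "'a::real_normed_vector set \<Rightarrow> ('a \<Rightarrow> 'b::real_normed_vector) \<Rightarrow> bool" where
  "smooth_on S f \<longleftrightarrow> (\<forall>k. Ck_on k S f)"

type_synonym ('m, 'e) chart = "'m set \<times> ('m \<Rightarrow> 'e)"

definition chart_inv :: "('m, 'e) chart \<Rightarrow> 'e \<Rightarrow> 'm" where
  "chart_inv c = inv_into (fst c) (snd c)"

definition coord_rep :: "('m, 'e) chart \<Rightarrow> ('n, 'f) chart \<Rightarrow> ('m \<Rightarrow> 'n) \<Rightarrow> 'e \<Rightarrow> 'f" where
  "coord_rep c c' f = snd c' \<circ> f \<circ> chart_inv c"

text \<open>The model space is a finite-dimensional normed space rather than a type of class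
  \<open>euclidean_space\<close>, because the latter would exclude manifolds of dimension 0.\<close>

definition smooth_manifold ::
  "('m::{t2_space, second_countable_topology}, 'e::real_normed_vector) chart set \<Rightarrow> bool" where
  "smooth_manifold A \<longleftrightarrow>
     (\<exists>B::'e set. finite B \<and> span B = UNIV) \<and>
     (\<Union>c\<in>A. fst c) = UNIV \<and>
     (\<forall>c\<in>A. open (fst c) \<and> open (snd c ` fst c) \<and>
        homeomorphism (fst c) (snd c ` fst c) (snd c) (chart_inv c)) \<and>
     (\<forall>c\<in>A. \<forall>c'\<in>A. smooth_on (snd c ` (fst c \<inter> fst c')) (coord_rep c c' id))"

definition smooth_map ::
  "('m::topological_space, 'e::real_normed_vector) chart set \<Rightarrow>
   ('n::topological_space, 'f::real_normed_vector) chart set \<Rightarrow> ('m \<Rightarrow> 'n) \<Rightarrow> bool" where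
  "smooth_map A B f \<longleftrightarrow> continuous_on UNIV f \<and>
     (\<forall>c\<in>A. \<forall>c'\<in>B. smooth_on (snd c ` (fst c \<inter> f -` fst c')) (coord_rep c c' f))"

definition prod_atlas ::
  "('m, 'e) chart set \<Rightarrow> ('n, 'f) chart set \<Rightarrow> ('m \<times> 'n, 'e \<times> 'f) chart set" where
  "prod_atlas A B = (\<lambda>(c, c'). (fst c \<times> fst c', map_prod (snd c) (snd c'))) ` (A \<times> B)"


section \<open>Lie groups and semisimplicity\<close>

definition lie_group ::
  "'g::{t2_space, second_countable_topology} monoid \<Rightarrow> ('g, 'e::real_normed_vector) chart set \<Rightarrow> bool"
where
  "lie_group K A \<longleftrightarrow> group K \<and> carrier K = UNIV \<and> smooth_manifold A \<and>
     smooth_map (prod_atlas A A) A (\<lambda>(x, y). x \<otimes>\<^bsub>K\<^esub> y) \<and>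
     smooth_map A A (\<lambda>x. inv\<^bsub>K\<^esub> x)"

definition smooth_functions ::
  "('g::topological_space, 'e::real_normed_vector) chart set \<Rightarrow> ('g \<Rightarrow> real) set" where
  "smooth_functions A = {f. smooth_map A {(UNIV, id)} f}"

type_synonym 'g operator = "('g \<Rightarrow> real) \<Rightarrow> ('g \<Rightarrow> real)"

text \<open>The Lie algebra of left-invariant vector fields, a vector field being a derivation of the
  algebra of smooth functions. Values at non-smooth functions are normalised to 0, so that
  derivations are equal as soon as they agree on smooth functions.\<close>

definition lie_algebra ::
  "'g::topological_space monoid \<Rightarrow> ('g, 'e::real_normed_vector) chart set \<Rightarrow> 'g operator set" where
  "lie_algebra K A = {X.
     (\<forall>f\<in>smooth_functions A. X f \<in> smooth_functions A) \<and>
     (\<forall>f. f \<notin> smooth_functions A \<longrightarrow> X f = (\<lambda>_. 0)) \<and>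
     (\<forall>f\<in>smooth_functions A. \<forall>h\<in>smooth_functions A. \<forall>a b::real.
        X (\<lambda>x. a * f x + b * h x) = (\<lambda>x. a * X f x + b * X h x)) \<and>
     (\<forall>f\<in>smooth_functions A. \<forall>h\<in>smooth_functions A.
        X (\<lambda>x. f x * h x) = (\<lambda>x. X f x * h x + f x * X h x)) \<and>
     (\<forall>f\<in>smooth_functions A. \<forall>s. X (\<lambda>x. f (s \<otimes>\<^bsub>K\<^esub> x)) = (\<lambda>x. X f (s \<otimes>\<^bsub>K\<^esub> x)))}"

definition lie_bracket :: "'g operator \<Rightarrow> 'g operator \<Rightarrow> 'g operator" where
  "lie_bracket X Y = (\<lambda>f x. X (Y f) x - Y (X f) x)"

definition op_zero :: "'g operator" where
  "op_zero = (\<lambda>f x. 0)"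

definition op_subspace :: "'g operator set \<Rightarrow> bool" where
  "op_subspace V \<longleftrightarrow> op_zero \<in> V \<and>
     (\<forall>X\<in>V. \<forall>Y\<in>V. \<forall>a b::real. (\<lambda>f x. a * X f x + b * Y f x) \<in> V)"

definition lie_ideal :: "'g operator set \<Rightarrow> 'g operator set \<Rightarrow> bool" where
  "lie_ideal L I \<longleftrightarrow> I \<subseteq> L \<and> op_subspace I \<and> (\<forall>X\<in>L. \<forall>Y\<in>I. lie_bracket X Y \<in> I)"

primrec derived_series :: "'g operator set \<Rightarrow> nat \<Rightarrow> 'g operator set" where
  "derived_series I 0 = I"
| "derived_series I (Suc k) = op_subspace hull
     {lie_bracket X Y | X Y. X \<in> derived_series I k \<and> Y \<in> derived_series I k}"

definition semisimple_lie_algebra :: "'g operator set \<Rightarrow> bool" where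
  "semisimple_lie_algebra L \<longleftrightarrow>
     (\<forall>I. lie_ideal L I \<and> (\<exists>k. derived_series I k = {op_zero}) \<longrightarrow> I = {op_zero})"

definition semisimple_lie_group ::
  "'g::{t2_space, second_countable_topology} monoid \<Rightarrow> ('g, 'e::real_normed_vector) chart set \<Rightarrow> bool"
where
  "semisimple_lie_group K A \<longleftrightarrow> lie_group K A \<and> semisimple_lie_algebra (lie_algebra K A)"


section \<open>Riemannian symmetric spaces\<close>

text \<open>\<open>g c p u v\<close> is the inner product at \<open>p\<close> of the tangent vectors whose coordinates in the
  chart \<open>c\<close> are \<open>u\<close> and \<open>v\<close>.\<close>

type_synonym ('m, 'e) metric_field = "('m, 'e) chart \<Rightarrow> 'm \<Rightarrow> 'e \<Rightarrow> 'e \<Rightarrow> real"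

definition preserves_metric ::
  "('m, 'e::real_normed_vector) chart set \<Rightarrow> ('m, 'e) metric_field \<Rightarrow> ('m \<Rightarrow> 'm) \<Rightarrow> bool" where
  "preserves_metric A g f \<longleftrightarrow>
     (\<forall>c\<in>A. \<forall>c'\<in>A. \<forall>p. p \<in> fst c \<and> f p \<in> fst c' \<longrightarrow>
        (let D = frechet_derivative (coord_rep c c' f) (at (snd c p))
         in \<forall>u v. g c p u v = g c' (f p) (D u) (D v)))"

text \<open>Preservation by the identity is the transformation rule under changes of charts.\<close>

definition riemannian_metric ::
  "('m::{t2_space, second_countable_topology}, 'e::real_normed_vector) chart set \<Rightarrow>
   ('m, 'e) metric_field \<Rightarrow> bool" where
  "riemannian_metric A g \<longleftrightarrow> preserves_metric A g id \<and>
     (\<forall>c\<in>A. \<forall>p\<in>fst c. bilinear (g c p) \<and>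
        (\<forall>u v. g c p u v = g c p v u) \<and> (\<forall>u. u \<noteq> 0 \<longrightarrow> 0 < g c p u u)) \<and>
     (\<forall>c\<in>A. \<forall>u v. smooth_on (snd c ` fst c) (\<lambda>z. g c (chart_inv c z) u v))"

definition riemannian_isometry ::
  "('m::topological_space, 'e::real_normed_vector) chart set \<Rightarrow> ('m, 'e) metric_field \<Rightarrow>
   ('m \<Rightarrow> 'm) \<Rightarrow> bool" where
  "riemannian_isometry A g f \<longleftrightarrow>
     bij f \<and> smooth_map A A f \<and> smooth_map A A (inv_into UNIV f) \<and> preserves_metric A g f"

text \<open>One-sided limits of the velocity at the break points are not required; the infimum of
  the lengths is not affected by this.\<close>

definition piecewise_C1_curve ::
  "('m::topological_space, 'e::real_normed_vector) chart set \<Rightarrow> (real \<Rightarrow> 'm) \<Rightarrow> bool" where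
  "piecewise_C1_curve A \<gamma> \<longleftrightarrow> continuous_on {0..1} \<gamma> \<and>
     (\<exists>T. finite T \<and>
        (\<forall>c\<in>A. (snd c \<circ> \<gamma>) C1_differentiable_on {t \<in> {0<..<1} - T. \<gamma> t \<in> fst c}))"

definition speed ::
  "('m, 'e::real_normed_vector) chart set \<Rightarrow> ('m, 'e) metric_field \<Rightarrow> (real \<Rightarrow> 'm) \<Rightarrow> real \<Rightarrow> real"
where
  "speed A g \<gamma> t =
     (let c = (SOME c. c \<in> A \<and> \<gamma> t \<in> fst c);
          w = vector_derivative (snd c \<circ> \<gamma>) (at t)
      in sqrt (g c (\<gamma> t) w w))"

definition curve_length ::
  "('m, 'e::real_normed_vector) chart set \<Rightarrow> ('m, 'e) metric_field \<Rightarrow> (real \<Rightarrow> 'm) \<Rightarrow> ennreal" where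
  "curve_length A g \<gamma> = (\<integral>\<^sup>+t\<in>{0<..<1}. ennreal (speed A g \<gamma> t) \<partial>lborel)"

definition riemannian_distance ::
  "('m::topological_space, 'e::real_normed_vector) chart set \<Rightarrow> ('m, 'e) metric_field \<Rightarrow>
   'm \<Rightarrow> 'm \<Rightarrow> ennreal" where
  "riemannian_distance A g x y =
     (INF \<gamma>\<in>{\<gamma>. piecewise_C1_curve A \<gamma> \<and> \<gamma> 0 = x \<and> \<gamma> 1 = y}. curve_length A g \<gamma>)"

definition riemannian_symmetric_space ::
  "('m::{t2_space, second_countable_topology}, 'e::real_normed_vector) chart set \<Rightarrow>
   ('m, 'e) metric_field \<Rightarrow> bool" where
  "riemannian_symmetric_space A g \<longleftrightarrow>
     smooth_manifold A \<and> riemannian_metric A g \<and> connected (UNIV :: 'm set) \<and>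
     (\<forall>p. \<exists>s. riemannian_isometry A g s \<and> s \<circ> s = id \<and> s p = p \<and>
        (\<exists>N. open N \<and> p \<in> N \<and> (\<forall>x\<in>N. s x = x \<longrightarrow> x = p)))"


section \<open>Random walk multisets and empirical measures\<close>

definition sym_mset :: "'g monoid \<Rightarrow> 'g set \<Rightarrow> 'g multiset" where
  "sym_mset K S = mset_set S + image_mset (\<lambda>s. inv\<^bsub>K\<^esub> s) (mset_set S)"

primrec word_mset :: "'g monoid \<Rightarrow> 'g multiset \<Rightarrow> nat \<Rightarrow> 'g multiset" where
  "word_mset K T 0 = {#\<one>\<^bsub>K\<^esub>#}"
| "word_mset K T (Suc l) = (\<Sum>s\<in>#T. image_mset (\<lambda>t. s \<otimes>\<^bsub>K\<^esub> t) (word_mset K T l))"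

definition empirical_measure :: "'m::topological_space multiset \<Rightarrow> 'm measure" where
  "empirical_measure P = distr (measure_pmf (pmf_of_multiset P)) borel (\<lambda>x. x)"


section \<open>Wasserstein and Prokhorov distances\<close>

definition couplings :: "'a measure \<Rightarrow> 'b measure \<Rightarrow> ('a \<times> 'b) measure set" where
  "couplings \<mu> \<nu> = {\<pi>. sets \<pi> = sets (\<mu> \<Otimes>\<^sub>M \<nu>) \<and> distr \<pi> \<mu> fst = \<mu> \<and> distr \<pi> \<nu> snd = \<nu>}"

definition wasserstein1 :: "('a \<Rightarrow> 'a \<Rightarrow> real) \<Rightarrow> 'a measure \<Rightarrow> 'a measure \<Rightarrow> real" where
  "wasserstein1 d \<mu> \<nu> = enn2real (INF \<pi>\<in>couplings \<mu> \<nu>. \<integral>\<^sup>+z. ennreal (d (fst z) (snd z)) \<partial>\<pi>)"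

definition prokhorov :: "('b \<Rightarrow> 'b \<Rightarrow> ennreal) \<Rightarrow> 'b measure \<Rightarrow> 'b measure \<Rightarrow> real" where
  "prokhorov d \<mu> \<nu> = Inf {\<epsilon>. 0 < \<epsilon> \<and> (\<forall>A\<in>sets \<mu>.
     let A\<epsilon> = {y \<in> space \<mu>. \<exists>x\<in>A. d x y < ennreal \<epsilon>}
     in emeasure \<mu> A \<le> emeasure \<nu> A\<epsilon> + ennreal \<epsilon> \<and> emeasure \<nu> A \<le> emeasure \<mu> A\<epsilon> + ennreal \<epsilon>)}"


section \<open>Barcodes and the bottleneck distance\<close>

text \<open>A bar is recorded by its birth and its (possibly infinite) death. Simplices enter the
  Vietoris--Rips complex at scales strictly above their diameter, so the intervals
  are open on the left and closed on the right.\<close>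

type_synonym bar = "real \<times> ereal"

definition bar_interval :: "bar \<Rightarrow> real set" where
  "bar_interval I = {x. fst I < x \<and> ereal x \<le> snd I}"

definition barcodes :: "bar multiset set" where
  "barcodes = {B. \<forall>I\<in>#B. ereal (fst I) < snd I}"

definition eps_matching :: "real \<Rightarrow> bar multiset \<Rightarrow> bar multiset \<Rightarrow> (bar \<times> bar) multiset \<Rightarrow> bool" where
  "eps_matching \<epsilon> B C M \<longleftrightarrow>
     image_mset fst M \<subseteq># B \<and> image_mset snd M \<subseteq># C \<and>
     (\<forall>(I, J)\<in>#M. \<bar>fst I - fst J\<bar> \<le> \<epsilon> \<and> (snd I = snd J \<or> \<bar>snd I - snd J\<bar> \<le> ereal \<epsilon>)) \<and>
     (\<forall>I\<in>#(B - image_mset fst M) + (C - image_mset snd M). snd I - ereal (fst I) \<le> ereal (2 * \<epsilon>))"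

definition bottleneck :: "bar multiset \<Rightarrow> bar multiset \<Rightarrow> ennreal" where
  "bottleneck B C = (INF \<epsilon>\<in>{\<epsilon>. 0 \<le> \<epsilon> \<and> (\<exists>M. eps_matching \<epsilon> B C M)}. ennreal \<epsilon>)"

definition barcode_borel :: "bar multiset measure" where
  "barcode_borel = sigma barcodes {U. U \<subseteq> barcodes \<and>
     (\<forall>B\<in>U. \<exists>\<epsilon>>0. \<forall>C\<in>barcodes. bottleneck B C < ennreal \<epsilon> \<longrightarrow> C \<in> U)}"


section \<open>Persistent homology of Vietoris--Rips filtrations\<close>

text \<open>The vertices of the complex of a tuple \<open>y 0, \<dots>, y (n - 1)\<close> are the indices. As
  \<open>i = j\<close> is allowed, the complex at scale 0 is empty.\<close>

definition vietoris_rips :: "nat \<Rightarrow> ('m \<Rightarrow> 'm \<Rightarrow> real) \<Rightarrow> (nat \<Rightarrow> 'm) \<Rightarrow> real \<Rightarrow> nat set set" where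
  "vietoris_rips n d y x =
     {s. s \<subseteq> {..<n} \<and> s \<noteq> {} \<and> (\<forall>i\<in>s. \<forall>j\<in>s. d (y i) (y j) < x)}"

text \<open>Simplicial chains with field coefficients, simplices being oriented by the order of
  their vertices: \<open>w\<close> occurs in the boundary of \<open>insert v w\<close> with the sign given by the
  position of \<open>v\<close>. Homology is unreduced.\<close>

definition chains :: "nat set set \<Rightarrow> nat \<Rightarrow> (nat set \<Rightarrow> 'f::field) set" where
  "chains X q = {c. \<forall>s. c s \<noteq> 0 \<longrightarrow> s \<in> X \<and> card s = Suc q}"

definition boundary_map :: "nat \<Rightarrow> (nat set \<Rightarrow> 'f::field) \<Rightarrow> nat set \<Rightarrow> 'f" where
  "boundary_map n c w =
     (if w = {} then 0 else \<Sum>v\<in>{..<n} - w. (-1) ^ card {u\<in>w. u < v} * c (insert v w))"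

definition cycles :: "nat \<Rightarrow> nat set set \<Rightarrow> nat \<Rightarrow> (nat set \<Rightarrow> 'f::field) set" where
  "cycles n X q = {c \<in> chains X q. boundary_map n c = (\<lambda>_. 0)}"

definition boundaries :: "nat \<Rightarrow> nat set set \<Rightarrow> nat \<Rightarrow> (nat set \<Rightarrow> 'f::field) set" where
  "boundaries n X q = boundary_map n ` chains X (Suc q)"

text \<open>For increasing families of subspaces \<open>B x \<subseteq> Z x\<close> (\<open>x \<ge> 0\<close>), the quotients
  \<open>Z x / B x\<close> form a persistence module. An isomorphism onto it from the direct sum of the
  interval modules of the bars \<open>bs\<close> is the same as classes (of \<open>z i x\<close>), one for each bar
  \<open>i\<close> and each \<open>x\<close> in its interval, which form a basis of \<open>Z x / B x\<close> for every \<open>x\<close> and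
  which the structure maps send to one another, or to 0 once the bar has ended.\<close>

definition interval_decomposition ::
  "(real \<Rightarrow> ('s \<Rightarrow> 'f::field) set) \<Rightarrow> (real \<Rightarrow> ('s \<Rightarrow> 'f) set) \<Rightarrow> bar list \<Rightarrow>
   (nat \<Rightarrow> real \<Rightarrow> 's \<Rightarrow> 'f) \<Rightarrow> bool" where
  "interval_decomposition Z B bs z \<longleftrightarrow>
     (\<forall>I\<in>set bs. 0 \<le> fst I \<and> ereal (fst I) < snd I) \<and>
     (\<forall>x\<ge>0. let alive = {i. i < length bs \<and> x \<in> bar_interval (bs ! i)} in
        (\<forall>i\<in>alive. z i x \<in> Z x) \<and>
        (\<forall>a. (\<lambda>s. \<Sum>i\<in>alive. a i * z i x s) \<in> B x \<longrightarrow> (\<forall>i\<in>alive. a i = 0)) \<and>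
        (\<forall>c\<in>Z x. \<exists>a. (\<lambda>s. c s - (\<Sum>i\<in>alive. a i * z i x s)) \<in> B x)) \<and>
     (\<forall>i<length bs. \<forall>x\<in>bar_interval (bs ! i). \<forall>y\<ge>x.
        if y \<in> bar_interval (bs ! i) then (\<lambda>s. z i y s - z i x s) \<in> B y else z i x \<in> B y)"

definition PH ::
  "'f::field itself \<Rightarrow> nat \<Rightarrow> nat \<Rightarrow> ('m \<Rightarrow> 'm \<Rightarrow> real) \<Rightarrow> (nat \<Rightarrow> 'm) \<Rightarrow> bar multiset" where
  "PH F q n d y = (THE C. \<exists>bs (z :: nat \<Rightarrow> real \<Rightarrow> nat set \<Rightarrow> 'f). C = mset bs \<and>
     interval_decomposition (\<lambda>x. cycles n (vietoris_rips n d y x) q)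
                            (\<lambda>x. boundaries n (vietoris_rips n d y x) q) bs z)"

text \<open>The metric measure space is \<open>(space \<mu>, d, \<mu>)\<close>.\<close>

definition PH_law ::
  "'f::field itself \<Rightarrow> nat \<Rightarrow> nat \<Rightarrow> ('m \<Rightarrow> 'm \<Rightarrow> real) \<Rightarrow> 'm measure \<Rightarrow> bar multiset measure" where
  "PH_law F q n d \<mu> = distr (Pi\<^sub>M {..<n} (\<lambda>_. \<mu>)) barcode_borel (PH F q n d)"

end

theory Submission
  imports Defs
begin

text \<open>
  Couple \<open>\<sigma>\<close> and \<open>\<sigma>\<^sub>l\<close> at a cost close to \<open>W\<^sub>1\<close> and take the \<open>n\<close>-fold product of the coupling.
  Moving every point of a tuple by at most \<open>\<delta>\<close> changes all diameters by at most \<open>2\<delta>\<close>, hence the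
  barcode by at most \<open>2\<delta>\<close> in the bottleneck distance. By Markov's inequality and a union bound, the
  Prokhorov distance of the laws is at most \<open>sqrt (2 n W\<^sub>1)\<close>, and \<open>2 n \<le> n\<^sup>2\<close> because the
  symmetrised set has at least two elements.

  Stability of barcodes is proved by interpolating linearly between two filtrations. Filtrations
  that admit a common ordering of the simplices share a basis of the chain complex in which the
  boundary operator pairs basis elements (Barannikov's normal form), and then corresponding bars
  have close endpoints. A filtration admits a common ordering with every filtration close to it, so the
  barcode is 1-Lipschitz along the segment.
\<close>

section \<open>Matchings of barcodes\<close>

text \<open>\<open>PH\<close> is a definite description, so it says nothing until interval
  decompositions are known to be unique; the ranks of the maps between two scales settle this. The
  obstacle to stability is that two filtrations may sort the simplices in conflicting ways, and then
  the pairing of births with deaths found for one tells nothing about the other. For a fixed pairing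
  every bar consists of two filtration values, so changing the values by at most \<epsilon> moves
  its ends by at most \<epsilon>. Along the segment the pairing changes only where values collide;
  there two orderings describe the same filtration, and uniqueness makes both give the same barcode.
  Closeness of barcodes must then compose with additive constants, which dictates the padded form of
  matchings used below. The constant 2 n comes from Markov's inequality at the threshold \<epsilon>
  / 2, since barcodes move twice as far as points: with a coupling of cost c, some coordinate fails
  with probability at most 2 n c / \<epsilon>, and this is at most \<epsilon> exactly if 2 n c is at
  most the square of \<epsilon>.\<close>

definition bars_close :: "real \<Rightarrow> bar \<Rightarrow> bar \<Rightarrow> bool" where
  "bars_close \<epsilon> I J \<longleftrightarrow>
     \<bar>fst I - fst J\<bar> \<le> \<epsilon> \<and> (snd I = snd J \<or> \<bar>snd I - snd J\<bar> \<le> ereal \<epsilon>)"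

definition bar_short :: "real \<Rightarrow> bar \<Rightarrow> bool" where
  "bar_short \<epsilon> I \<longleftrightarrow> snd I - ereal (fst I) \<le> ereal (2 * \<epsilon>)"

text \<open>\<open>None\<close> stands for the diagonal.  Allowing two short bars to be related makes the relation
  compose: a short bar may travel through the diagonal into another short bar.\<close>

fun bars_related :: "real \<Rightarrow> bar option \<Rightarrow> bar option \<Rightarrow> bool" where
  "bars_related \<epsilon> (Some I) (Some J) \<longleftrightarrow> bars_close \<epsilon> I J \<or> bar_short \<epsilon> I \<and> bar_short \<epsilon> J"
| "bars_related \<epsilon> (Some I) None \<longleftrightarrow> bar_short \<epsilon> I"
| "bars_related \<epsilon> None (Some J) \<longleftrightarrow> bar_short \<epsilon> J"
| "bars_related \<epsilon> None None \<longleftrightarrow> True"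

text \<open>Diagonal points turn a partial matching into a total one, to which
  \<open>rel_mset\<close> applies. Their number is left free in \<open>near_barcodes\<close>,
  because composing matchings requires more of them.\<close>

definition padded :: "nat \<Rightarrow> 'a multiset \<Rightarrow> 'a option multiset" where
  "padded k B = image_mset Some B + replicate_mset k None"

definition near_barcodes :: "real \<Rightarrow> bar multiset \<Rightarrow> bar multiset \<Rightarrow> bool" where
  "near_barcodes \<epsilon> B C \<longleftrightarrow> (\<exists>k l. rel_mset (bars_related \<epsilon>) (padded k B) (padded l C))"

lemma bars_close_trans:
  assumes "bars_close \<epsilon> I J" "bars_close \<delta> J L"
  shows "bars_close (\<epsilon> + \<delta>) I L"
proof -
  have "\<epsilon> \<ge> 0" "\<delta> \<ge> 0"
    using assms by (auto simp: bars_close_def)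
  then show ?thesis
    using assms unfolding bars_close_def
    by (cases "snd I"; cases "snd J"; cases "snd L") auto
qed

lemma bars_close_sym: "bars_close \<epsilon> I J \<longleftrightarrow> bars_close \<epsilon> J I"
  unfolding bars_close_def
  by (cases "snd I"; cases "snd J") (auto simp: abs_minus_commute)

text \<open>Moving both ends by at most \<delta> lengthens a bar by at most 2 \<delta>; this is what
  the factor 2 in \<open>bar_short\<close> absorbs.\<close>

lemma bar_short_close:
  assumes "bar_short \<epsilon> I" "bars_close \<delta> I J"
  shows "bar_short (\<epsilon> + \<delta>) J"
  using assms unfolding bars_close_def bar_short_def
  by (cases "snd I"; cases "snd J") auto

lemma bar_short_mono: "bar_short \<epsilon> I \<Longrightarrow> \<epsilon> \<le> \<delta> \<Longrightarrow> bar_short \<delta> I"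
  unfolding bar_short_def by (cases "snd I") auto

lemma bars_related_sym: "bars_related \<epsilon> u v \<longleftrightarrow> bars_related \<epsilon> v u"
  by (cases u; cases v) (auto simp: bars_close_sym)

lemma bars_related_trans:
  assumes "0 \<le> \<epsilon>" "0 \<le> \<delta>" "bars_related \<epsilon> u v" "bars_related \<delta> v w"
  shows "bars_related (\<epsilon> + \<delta>) u w"
proof -
  have short: "bar_short (\<epsilon> + \<delta>) I" if "bar_short \<epsilon> I \<or> bar_short \<delta> I" for I
    using that assms(1,2) bar_short_mono by fastforce
  have lr: "bar_short (\<epsilon> + \<delta>) J" if "bar_short \<epsilon> I" "bars_close \<delta> I J" for I J
    using bar_short_close that by blast
  have rl: "bar_short (\<epsilon> + \<delta>) J" if "bar_short \<delta> I" "bars_close \<epsilon> J I" for I J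
    using bar_short_close[of \<delta> I \<epsilon> J] that by (simp add: bars_close_sym add.commute)
  show ?thesis
    using assms(3,4) short lr rl bars_close_trans
    by (cases u; cases v; cases w) (auto; blast)+
qed

lemma rel_mset_replicate: "R a b \<Longrightarrow> rel_mset R (replicate_mset k a) (replicate_mset k b)"
  by (induction k) (auto intro: rel_mset_Zero rel_mset_Plus)

lemma rel_mset_replicate_right:
  "(\<And>a. a \<in># A \<Longrightarrow> R a b) \<Longrightarrow> rel_mset R A (replicate_mset (size A) b)"
  by (induction A) (auto intro: rel_mset_Zero rel_mset_Plus)

lemma rel_mset_replicate_left:
  "(\<And>a. a \<in># A \<Longrightarrow> R b a) \<Longrightarrow> rel_mset R (replicate_mset (size A) b) A"
  by (induction A) (auto intro: rel_mset_Zero rel_mset_Plus)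

lemma rel_mset_add:
  assumes "rel_mset R A B" "rel_mset R C D"
  shows "rel_mset R (A + C) (B + D)"
  using assms(1)
proof (induction A arbitrary: B)
  case empty
  then have "B = {#}"
    using rel_mset_size by fastforce
  then show ?case using assms(2) by simp
next
  case (add x A)
  then obtain y B' where "B = add_mset y B'" "R x y" "rel_mset R A B'"
    using msed_rel_invL by metis
  then show ?case using add.IH[of B'] by (simp add: rel_mset_Plus)
qed

lemma padded_add: "padded (k + m) B = padded k B + replicate_mset m None"
  by (simp add: padded_def ac_simps) (simp add: multiset_eq_iff)

lemma rel_mset_padded_add:
  assumes "rel_mset (bars_related \<epsilon>) (padded k B) (padded l C)"
  shows "rel_mset (bars_related \<epsilon>) (padded (k + m) B) (padded (l + m) C)"
  unfolding padded_add by (intro rel_mset_add assms rel_mset_replicate) simp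

lemma near_barcodes_sym: "near_barcodes \<epsilon> B C \<Longrightarrow> near_barcodes \<epsilon> C B"
proof -
  have "conversep (bars_related \<epsilon>) = bars_related \<epsilon>"
    by (auto simp: fun_eq_iff bars_related_sym)
  then show "near_barcodes \<epsilon> B C \<Longrightarrow> near_barcodes \<epsilon> C B"
    unfolding near_barcodes_def by (metis multiset.rel_flip)
qed

text \<open>The two relations meet at \<open>C\<close> with different paddings \<open>l\<close> and
  \<open>l'\<close>. Padding both up to \<open>l + l'\<close> lets them compose, and
  \<open>bars_related_trans\<close> handles the individual bars.\<close>

lemma near_barcodes_trans:
  assumes "0 \<le> \<epsilon>" "0 \<le> \<delta>" "near_barcodes \<epsilon> B C" "near_barcodes \<delta> C D"
  shows "near_barcodes (\<epsilon> + \<delta>) B D"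
proof -
  obtain k l where kl: "rel_mset (bars_related \<epsilon>) (padded k B) (padded l C)"
    using assms unfolding near_barcodes_def by blast
  obtain l' m where lm: "rel_mset (bars_related \<delta>) (padded l' C) (padded m D)"
    using assms unfolding near_barcodes_def by blast
  have "rel_mset (bars_related \<delta>) (padded (l + l') C) (padded (m + l) D)"
    using rel_mset_padded_add[OF lm, of l] by (simp add: add.commute)
  then have "rel_mset (bars_related \<epsilon> OO bars_related \<delta>) (padded (k + l') B) (padded (m + l) D)"
    unfolding multiset.rel_compp using rel_mset_padded_add[OF kl, of l'] by blast
  moreover have "bars_related \<epsilon> OO bars_related \<delta> \<le> bars_related (\<epsilon> + \<delta>)"
    using bars_related_trans[OF assms(1,2)] by blast
  ultimately show ?thesis
    unfolding near_barcodes_def using multiset.rel_mono by blast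
qed

section \<open>Matchings and the bottleneck distance\<close>

lemma eps_matching_iff:
  "eps_matching \<epsilon> B C M \<longleftrightarrow>
     image_mset fst M \<subseteq># B \<and> image_mset snd M \<subseteq># C \<and>
     (\<forall>(I, J)\<in>#M. bars_close \<epsilon> I J) \<and>
     (\<forall>I\<in>#(B - image_mset fst M) + (C - image_mset snd M). bar_short \<epsilon> I)"
  by (simp add: eps_matching_def bars_close_def bar_short_def)

lemma eps_matching_near:
  assumes "eps_matching \<epsilon> B C M"
  shows "near_barcodes \<epsilon> B C"
proof -
  define B' where "B' = B - image_mset fst M"
  define C' where "C' = C - image_mset snd M"
  have B: "B = image_mset fst M + B'" and C: "C = image_mset snd M + C'"
    using assms by (auto simp: eps_matching_iff B'_def C'_def)
  have short: "bar_short \<epsilon> I" if "I \<in># B' + C'" for I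
    using assms that unfolding eps_matching_iff B'_def[symmetric] C'_def[symmetric] by blast
  have M: "rel_mset (bars_related \<epsilon>) (image_mset Some (image_mset fst M))
        (image_mset Some (image_mset snd M))"
    using assms unfolding multiset.rel_map eps_matching_iff
    by (auto intro!: multiset.rel_refl_strong)
  have 1: "rel_mset (bars_related \<epsilon>) (image_mset Some B') (replicate_mset (size B') None)"
    using rel_mset_replicate_right[of "image_mset Some B'" "bars_related \<epsilon>" None] short by fastforce
  have 2: "rel_mset (bars_related \<epsilon>) (replicate_mset (size C') None) (image_mset Some C')"
    using rel_mset_replicate_left[of "image_mset Some C'" "bars_related \<epsilon>" None] short by fastforce
  \<comment> \<open>The paddings are crossed: each unmatched bar of \<open>B\<close> needs a
    diagonal point on the side of \<open>C\<close>, and conversely.\<close>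
  have "rel_mset (bars_related \<epsilon>) (padded (size C') B) (padded (size B') C)"
    unfolding padded_def
    using rel_mset_add[OF M rel_mset_add[OF 1 2]] by (simp add: B C ac_simps)
  then show ?thesis
    unfolding near_barcodes_def by blast
qed

text \<open>Only the pairs of close bars are kept. Two short bars that are related without being
  close are separated, and each of them may stay unmatched on its own.\<close>

lemma near_eps_matching:
  assumes "near_barcodes \<epsilon> B C"
  obtains M where "eps_matching \<epsilon> B C M"
proof -
  obtain k l where "rel_mset (bars_related \<epsilon>) (padded k B) (padded l C)"
    using assms unfolding near_barcodes_def by blast
  then obtain X where X: "set_mset X \<subseteq> {(u, v). bars_related \<epsilon> u v}"
      "image_mset fst X = padded k B" "image_mset snd X = padded l C"
    unfolding multiset.in_rel by auto
  define good where
    "good = (\<lambda>(u, v). u \<noteq> None \<and> v \<noteq> None \<and> bars_close \<epsilon> (the u) (the v))"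
  define M where "M = image_mset (map_prod the the) (filter_mset good X)"
  \<comment> \<open>Used for both projections \<open>h\<close>: deleting the diagonal points
    recovers the barcode, split into the bars of kept pairs and the unmatched ones.\<close>
  have part: "D = image_mset (the \<circ> h) (filter_mset good X) +
        image_mset (the \<circ> h) (filter_mset (\<lambda>z. h z \<noteq> None \<and> \<not> good z) X)"
    if h: "image_mset h X = padded m D" and hg: "\<And>z. good z \<Longrightarrow> h z \<noteq> None" for h m D
  proof -
    have "D = image_mset the (filter_mset (\<lambda>u. u \<noteq> None) (padded m D))"
      by (simp add: padded_def filter_mset_image_mset multiset.map_comp o_def)
    also have "\<dots> = image_mset (the \<circ> h) (filter_mset (\<lambda>z. h z \<noteq> None) X)"
      unfolding h[symmetric] by (simp add: filter_mset_image_mset multiset.map_comp)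
    also have "filter_mset (\<lambda>z. h z \<noteq> None) X =
        filter_mset good X + filter_mset (\<lambda>z. h z \<noteq> None \<and> \<not> good z) X"
    proof (rule multiset_eqI)
      fix z
      show "count (filter_mset (\<lambda>z. h z \<noteq> None) X) z =
          count (filter_mset good X + filter_mset (\<lambda>z. h z \<noteq> None \<and> \<not> good z) X) z"
        using hg[of z] by (cases "good z") simp_all
    qed
    finally show ?thesis by (simp only: image_mset_union)
  qed
  have B: "B = image_mset fst M +
        image_mset (the \<circ> fst) (filter_mset (\<lambda>z. fst z \<noteq> None \<and> \<not> good z) X)"
    using part[OF X(2)] by (auto simp: good_def M_def multiset.map_comp o_def)
  have C: "C = image_mset snd M +
        image_mset (the \<circ> snd) (filter_mset (\<lambda>z. snd z \<noteq> None \<and> \<not> good z) X)"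
    using part[OF X(3)] by (auto simp: good_def M_def multiset.map_comp o_def)
  have short: "bar_short \<epsilon> (the (fst z))"
    if "z \<in># X" "\<not> good z" "fst z \<noteq> None" for z
    using that X(1) by (cases "fst z"; cases "snd z"; auto simp: good_def)
  have short': "bar_short \<epsilon> (the (snd z))"
    if "z \<in># X" "\<not> good z" "snd z \<noteq> None" for z
    using that X(1) by (cases "fst z"; cases "snd z"; auto simp: good_def)
  have "eps_matching \<epsilon> B C M"
    unfolding eps_matching_iff
  proof (intro conjI)
    show "image_mset fst M \<subseteq># B" by (subst B) simp
    show "image_mset snd M \<subseteq># C" by (subst C) simp
    show "\<forall>(I, J)\<in>#M. bars_close \<epsilon> I J" by (auto simp: M_def good_def)
    have B': "B - image_mset fst M =
        image_mset (the \<circ> fst) (filter_mset (\<lambda>z. fst z \<noteq> None \<and> \<not> good z) X)"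
      by (subst B) simp
    have C': "C - image_mset snd M =
        image_mset (the \<circ> snd) (filter_mset (\<lambda>z. snd z \<noteq> None \<and> \<not> good z) X)"
      by (subst C) simp
    show "\<forall>I\<in>#(B - image_mset fst M) + (C - image_mset snd M). bar_short \<epsilon> I"
    proof
      fix I
      assume "I \<in># (B - image_mset fst M) + (C - image_mset snd M)"
      then obtain z where "z \<in># X" "\<not> good z"
          "fst z \<noteq> None \<and> I = the (fst z) \<or> snd z \<noteq> None \<and> I = the (snd z)"
        unfolding B' C' by (auto simp del: not_None_eq split_paired_Ex)
      then show "bar_short \<epsilon> I"
        using short short' by blast
    qed
  qed
  then show ?thesis using that by blast
qed

lemma bottleneck_le: "near_barcodes \<epsilon> B C \<Longrightarrow> 0 \<le> \<epsilon> \<Longrightarrow> bottleneck B C \<le> ennreal \<epsilon>"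
  unfolding bottleneck_def by (metis (mono_tags, lifting) INF_lower mem_Collect_eq near_eps_matching)

lemma bottleneck_less_iff:
  "bottleneck B C < ennreal \<epsilon> \<longleftrightarrow> (\<exists>\<delta>. 0 \<le> \<delta> \<and> \<delta> < \<epsilon> \<and> near_barcodes \<delta> B C)"
proof
  assume "bottleneck B C < ennreal \<epsilon>"
  then obtain \<delta> M where "0 \<le> \<delta>" "eps_matching \<delta> B C M" "ennreal \<delta> < ennreal \<epsilon>"
    unfolding bottleneck_def INF_less_iff by auto
  then show "\<exists>\<delta>. 0 \<le> \<delta> \<and> \<delta> < \<epsilon> \<and> near_barcodes \<delta> B C"
    using eps_matching_near by (auto simp: ennreal_less_iff)
next
  assume "\<exists>\<delta>. 0 \<le> \<delta> \<and> \<delta> < \<epsilon> \<and> near_barcodes \<delta> B C"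
  then obtain \<delta> where "0 \<le> \<delta>" "\<delta> < \<epsilon>" "near_barcodes \<delta> B C" by blast
  then show "bottleneck B C < ennreal \<epsilon>"
    by (meson bottleneck_le ennreal_lessI le_less_trans less_le_trans)
qed

section \<open>Uniqueness of interval decompositions\<close>

definition lin_closed :: "('s \<Rightarrow> 'f::field) set \<Rightarrow> bool" where
  "lin_closed V \<longleftrightarrow> (\<lambda>_. 0) \<in> V \<and>
     (\<forall>u\<in>V. \<forall>v\<in>V. \<forall>a b. (\<lambda>s. a * u s + b * v s) \<in> V)"

lemma lin_closedD:
  assumes "lin_closed V" "u \<in> V" "v \<in> V"
  shows "(\<lambda>s. a * u s + b * v s) \<in> V"
  using assms by (simp add: lin_closed_def)

lemma lin_closed_sum:
  assumes "lin_closed V" "\<And>i. i \<in> I \<Longrightarrow> z i \<in> V"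
  shows "(\<lambda>s. \<Sum>i\<in>I. a i * z i s) \<in> V"
  using assms(2)
proof (induction I rule: infinite_finite_induct)
  case (insert i I)
  have "(\<lambda>s. a i * z i s + 1 * (\<Sum>i\<in>I. a i * z i s)) \<in> V"
    by (rule lin_closedD[OF assms(1)]) (use insert in auto)
  with insert.hyps show ?case by simp
qed (use assms(1) in \<open>auto simp: lin_closed_def\<close>)

lemma lin_closed_add:
  assumes "lin_closed V" "u \<in> V" "v \<in> V"
  shows "(\<lambda>s. u s + v s) \<in> V"
  using lin_closedD[OF assms, of 1 1] by simp

text \<open>Gaussian elimination: an unknown \<open>m\<close> that occurs in equation
  \<open>k\<close> is expressed by the others, which removes one equation and one unknown. The value
  \<open>a' m\<close> is the one that solves equation \<open>k\<close>.\<close>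

lemma homogeneous_system_nontrivial_solution:
  fixes A :: "'j \<Rightarrow> 'i \<Rightarrow> 'f::field"
  assumes "finite I" "finite J" "card I < card J"
  shows "\<exists>a. (\<exists>j\<in>J. a j \<noteq> 0) \<and> (\<forall>i\<in>I. (\<Sum>j\<in>J. a j * A j i) = 0)"
  using assms
proof (induction I arbitrary: J A rule: finite_induct)
  case empty
  then obtain j where "j \<in> J" by fastforce
  then show ?case by (intro exI[of _ "\<lambda>_. 1"]) auto
next
  case (insert k I)
  show ?case
  proof (cases "\<forall>j\<in>J. A j k = 0")
    case True
    have "card I < card J" using insert by simp
    then obtain a where "\<exists>j\<in>J. a j \<noteq> 0" "\<forall>i\<in>I. (\<Sum>j\<in>J. a j * A j i) = 0"
      using insert.IH[of J A] insert.prems by blast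
    with True show ?thesis by (intro exI[of _ a]) auto
  next
    case False
    then obtain m where m: "m \<in> J" "A m k \<noteq> 0" by blast
    define J' where "J' = J - {m}"
    define A' where "A' = (\<lambda>j i. A j i - A j k / A m k * A m i)"
    have J': "finite J'" "card I < card J'" "J = insert m J'" "m \<notin> J'"
      using insert m by (auto simp: J'_def card_Diff_singleton)
    then obtain a where a: "\<exists>j\<in>J'. a j \<noteq> 0" "\<forall>i\<in>I. (\<Sum>j\<in>J'. a j * A' j i) = 0"
      using insert.IH[of J' A'] by blast
    define a' where "a' = a(m := - (\<Sum>j\<in>J'. a j * A j k) / A m k)"
    have eq: "(\<Sum>j\<in>J. a' j * A j i) = (\<Sum>j\<in>J'. a j * A' j i)" for i
    proof -
      have "(\<Sum>j\<in>J. a' j * A j i) = a' m * A m i + (\<Sum>j\<in>J'. a' j * A j i)"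
        using J' by simp
      also have "(\<Sum>j\<in>J'. a' j * A j i) = (\<Sum>j\<in>J'. a j * A j i)"
        using J'(4) by (intro sum.cong) (auto simp: a'_def)
      also have "a' m * A m i = - (\<Sum>j\<in>J'. a j * (A j k / A m k * A m i))"
        by (simp add: a'_def sum_distrib_left sum_distrib_right sum_divide_distrib mult.assoc)
      finally show ?thesis
        by (simp add: A'_def sum_subtractf right_diff_distrib)
    qed
    have "A' j k = 0" for j
      using m by (simp add: A'_def)
    then have "\<forall>i\<in>insert k I. (\<Sum>j\<in>J. a' j * A j i) = 0"
      using a(2) unfolding eq by simp
    moreover have "\<exists>j\<in>J. a' j \<noteq> 0"
      using a(1) J' by (auto simp: a'_def)
    ultimately show ?thesis by blast
  qed
qed

text \<open>For \<open>x \<le> y\<close> these are the bars alive at both scales, and in an interval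
  decomposition their number is the rank of the map from \<open>Z x / B x\<close> to
  \<open>Z y / B y\<close>. With \<open>x = y\<close> they are the bars alive at
  \<open>x\<close>.\<close>

definition bars_over :: "real \<Rightarrow> real \<Rightarrow> bar list \<Rightarrow> nat set" where
  "bars_over x y bs = {i. i < length bs \<and> fst (bs ! i) < x \<and> ereal y \<le> snd (bs ! i)}"

lemma interval_decompositionD:
  assumes "interval_decomposition Z B bs z"
  shows "\<And>I. I \<in> set bs \<Longrightarrow> 0 \<le> fst I \<and> ereal (fst I) < snd I"
    and "\<And>x i. 0 \<le> x \<Longrightarrow> i \<in> bars_over x x bs \<Longrightarrow> z i x \<in> Z x"
    and "\<And>x a i. 0 \<le> x \<Longrightarrow> (\<lambda>s. \<Sum>i\<in>bars_over x x bs. a i * z i x s) \<in> B x \<Longrightarrow>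
           i \<in> bars_over x x bs \<Longrightarrow> a i = 0"
    and "\<And>x c. 0 \<le> x \<Longrightarrow> c \<in> Z x \<Longrightarrow>
           \<exists>a. (\<lambda>s. c s - (\<Sum>i\<in>bars_over x x bs. a i * z i x s)) \<in> B x"
    and "\<And>x y i. i \<in> bars_over x x bs \<Longrightarrow> x \<le> y \<Longrightarrow> i \<in> bars_over y y bs \<Longrightarrow>
           (\<lambda>s. z i y s - z i x s) \<in> B y"
    and "\<And>x y i. i \<in> bars_over x x bs \<Longrightarrow> x \<le> y \<Longrightarrow> i \<notin> bars_over y y bs \<Longrightarrow>
           z i x \<in> B y"
proof -
  have eq: "{i. i < length bs \<and> x \<in> bar_interval (bs ! i)} = bars_over x x bs" for x
    by (auto simp: bars_over_def bar_interval_def)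
  note D = assms[unfolded interval_decomposition_def eq Let_def]
  note D1 = D[THEN conjunct1, rule_format]
  note D2 = D[THEN conjunct2, THEN conjunct1, rule_format]
  note D3 = D[THEN conjunct2, THEN conjunct2, rule_format]
  show "\<And>I. I \<in> set bs \<Longrightarrow> 0 \<le> fst I \<and> ereal (fst I) < snd I"
    by (rule D1)
  show "\<And>x i. 0 \<le> x \<Longrightarrow> i \<in> bars_over x x bs \<Longrightarrow> z i x \<in> Z x"
    by (rule D2[THEN conjunct1, rule_format])
  show "\<And>x a i. 0 \<le> x \<Longrightarrow> (\<lambda>s. \<Sum>i\<in>bars_over x x bs. a i * z i x s) \<in> B x \<Longrightarrow>
           i \<in> bars_over x x bs \<Longrightarrow> a i = 0"
    by (rule D2[THEN conjunct2, THEN conjunct1, rule_format])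
  show "\<And>x c. 0 \<le> x \<Longrightarrow> c \<in> Z x \<Longrightarrow>
           \<exists>a. (\<lambda>s. c s - (\<Sum>i\<in>bars_over x x bs. a i * z i x s)) \<in> B x"
    by (rule D2[THEN conjunct2, THEN conjunct2, rule_format])
  have in_bar: "i < length bs" "x \<in> bar_interval (bs ! i)" if "i \<in> bars_over x x bs" for i x
    using that by (simp_all flip: eq)
  show "(\<lambda>s. z i y s - z i x s) \<in> B y"
    if "i \<in> bars_over x x bs" "x \<le> y" "i \<in> bars_over y y bs" for x y i
    using D3[OF in_bar[OF that(1)] that(2)] in_bar(2)[OF that(3)] by simp
  show "z i x \<in> B y"
    if "i \<in> bars_over x x bs" "x \<le> y" "i \<notin> bars_over y y bs" for x y i
  proof -
    have "y \<notin> bar_interval (bs ! i)"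
      using in_bar(1)[OF that(1)] that(3) by (simp flip: eq)
    then show ?thesis
      using D3[OF in_bar[OF that(1)] that(2)] by simp
  qed
qed

text \<open>A comparison of ranks carried out without quotient spaces. Modulo \<open>B y\<close>,
  the classes of \<open>bs'\<close> that survive from \<open>x\<close> to \<open>y\<close> are
  combinations of the surviving classes of \<open>bs\<close>. If there were more of them, they would
  be dependent modulo \<open>B y\<close>, against their independence at \<open>y\<close>.\<close>

lemma card_bars_over_le:
  assumes lin: "\<And>x. lin_closed (B x)"
    and mono: "\<And>x y. x \<le> y \<Longrightarrow> B x \<subseteq> B y"
    and dec: "interval_decomposition Z B bs z" and dec': "interval_decomposition Z B bs' z'"
    and xy: "0 \<le> x" "x \<le> y"
  shows "card (bars_over x y bs') \<le> card (bars_over x y bs)"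
proof (rule ccontr)
  assume "\<not> ?thesis"
  then have less: "card (bars_over x y bs) < card (bars_over x y bs')" by simp
  have fin: "finite (bars_over u v cs)" for u v cs
    by (rule finite_subset[of _ "{..<length cs}"]) (auto simp: bars_over_def)
  have inter: "bars_over x y cs = bars_over x x cs \<inter> bars_over y y cs" for cs
    using xy(2) unfolding bars_over_def
    by (auto intro: order_trans[of "ereal x" "ereal y"])
  note D = interval_decompositionD[OF dec] and D' = interval_decompositionD[OF dec']
  define I where "I = bars_over x y bs"
  define J where "J = bars_over x y bs'"
  have "\<forall>j\<in>J. \<exists>a. (\<lambda>s. z' j x s - (\<Sum>i\<in>I. a i * z i x s)) \<in> B y"
  proof
    fix j
    assume "j \<in> J"
    then have "z' j x \<in> Z x"
      using D'(2) xy by (auto simp: J_def inter)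
    then obtain a where a: "(\<lambda>s. z' j x s - (\<Sum>i\<in>bars_over x x bs. a i * z i x s)) \<in> B x"
      using D(4) xy by blast
    have "(\<lambda>s. \<Sum>i\<in>bars_over x x bs - I. a i * z i x s) \<in> B y"
      using D(6) xy by (intro lin_closed_sum lin) (auto simp: I_def inter)
    then have "(\<lambda>s. z' j x s - (\<Sum>i\<in>bars_over x x bs. a i * z i x s) +
        (\<Sum>i\<in>bars_over x x bs - I. a i * z i x s)) \<in> B y"
      using a mono[OF xy(2)] by (intro lin_closed_add lin) auto
    moreover have "(\<Sum>i\<in>bars_over x x bs. a i * z i x s) =
        (\<Sum>i\<in>bars_over x x bs - I. a i * z i x s) + (\<Sum>i\<in>I. a i * z i x s)" for s
      by (rule sum.subset_diff) (auto simp: I_def inter fin)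
    ultimately show "\<exists>a. (\<lambda>s. z' j x s - (\<Sum>i\<in>I. a i * z i x s)) \<in> B y"
      by (auto simp: algebra_simps)
  qed
  then obtain A where A: "\<And>j. j \<in> J \<Longrightarrow> (\<lambda>s. z' j x s - (\<Sum>i\<in>I. A j i * z i x s)) \<in> B y"
    by metis
  obtain c where c: "\<exists>j\<in>J. c j \<noteq> 0" "\<forall>i\<in>I. (\<Sum>j\<in>J. c j * A j i) = 0"
    using homogeneous_system_nontrivial_solution[of I J A] less fin by (auto simp: I_def J_def)
  have "(\<lambda>s. \<Sum>j\<in>J. c j * (z' j x s - (\<Sum>i\<in>I. A j i * z i x s))) \<in> B y"
    by (intro lin_closed_sum lin A)
  moreover have "(\<Sum>j\<in>J. c j * (z' j x s - (\<Sum>i\<in>I. A j i * z i x s))) =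
      (\<Sum>j\<in>J. c j * z' j x s)" for s
  proof -
    have "(\<Sum>j\<in>J. c j * (\<Sum>i\<in>I. A j i * z i x s)) = (\<Sum>i\<in>I. (\<Sum>j\<in>J. c j * A j i) * z i x s)"
      by (simp add: sum_distrib_left sum_distrib_right mult.assoc sum.swap[of _ I J])
    also have "\<dots> = 0" using c(2) by simp
    finally show ?thesis by (simp add: right_diff_distrib sum_subtractf)
  qed
  ultimately have 1: "(\<lambda>s. \<Sum>j\<in>J. c j * z' j x s) \<in> B y" by simp
  \<comment> \<open>Independence is known for the representatives at \<open>y\<close>, so those at
    \<open>x\<close> are exchanged for them modulo \<open>B y\<close>.\<close>
  have 2: "(\<lambda>s. \<Sum>j\<in>J. c j * (z' j y s - z' j x s)) \<in> B y"
    using D'(5) xy by (intro lin_closed_sum lin) (auto simp: J_def inter)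
  have "(\<lambda>s. \<Sum>j\<in>J. c j * z' j y s) \<in> B y"
    using lin_closed_add[OF lin 1 2] by (simp add: right_diff_distrib sum_subtractf)
  moreover have "(\<Sum>j\<in>J. c j * z' j y s) =
      (\<Sum>j\<in>bars_over y y bs'. (if j \<in> J then c j else 0) * z' j y s)" for s
    by (rule sum.mono_neutral_cong_left) (auto simp: J_def inter fin)
  ultimately have "(if j \<in> J then c j else 0) = 0" if "j \<in> bars_over y y bs'" for j
    using D'(3)[of y "\<lambda>j. if j \<in> J then c j else 0" j] xy that by simp
  moreover have "J \<subseteq> bars_over y y bs'"
    by (simp add: J_def inter)
  ultimately have "\<forall>j\<in>J. c j = 0"
    by (metis subsetD)
  with c(1) show False by blast
qed

section \<open>Recovering a barcode from its rank counts\<close>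

definition count_over :: "real \<Rightarrow> real \<Rightarrow> bar multiset \<Rightarrow> nat" where
  "count_over x y B = size {#I \<in># B. fst I < x \<and> ereal y \<le> snd I#}"

lemma card_bars_over: "card (bars_over x y bs) = count_over x y (mset bs)"
proof -
  have "count_over x y (mset bs) = size (mset (filter (\<lambda>I. fst I < x \<and> ereal y \<le> snd I) bs))"
    unfolding count_over_def mset_filter ..
  then show ?thesis
    by (simp add: bars_over_def length_filter_conv_card del: mset_filter)
qed

lemma count_over_union: "count_over x y (B + C) = count_over x y B + count_over x y C"
  by (simp add: count_over_def)

text \<open>Without common bars, the earliest bar, taken as long as possible, is seen by a rank that no
  bar of the other barcode contributes to.\<close>

lemma barcode_eqI:
  assumes pos: "\<And>I. I \<in># B + C \<Longrightarrow> 0 \<le> fst I \<and> ereal (fst I) < snd I"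
    and eq: "\<And>x y. 0 \<le> x \<Longrightarrow> x \<le> y \<Longrightarrow> count_over x y B = count_over x y C"
  shows "B = C"
proof (rule ccontr)
  assume "B \<noteq> C"
  define B' where "B' = B - C"
  define C' where "C' = C - B"
  have disj: "I \<notin># C'" if "I \<in># B'" for I
    using that by (auto simp: B'_def C'_def in_diff_count)
  have "count_over x y B' = count_over x y C'" if "0 \<le> x" "x \<le> y" for x y
  proof -
    have "B = B' + (B \<inter># C)" "C = C' + (B \<inter># C)"
      unfolding B'_def C'_def by (rule multiset_eqI; simp)+
    from this[THEN arg_cong[where f = "count_over x y"]]
    have "count_over x y B = count_over x y B' + count_over x y (B \<inter># C)"
        "count_over x y C = count_over x y C' + count_over x y (B \<inter># C)"
      unfolding count_over_union .
    then show ?thesis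
      using eq[OF that] by simp
  qed note eq' = this
  define S where "S = set_mset (B' + C')"
  have "S \<noteq> {}"
    using \<open>B \<noteq> C\<close> by (auto simp: S_def B'_def C'_def Diff_eq_empty_iff_mset)
  have "finite S" by (simp add: S_def)
  have S_pos: "0 \<le> fst I \<and> ereal (fst I) < snd I" if "I \<in> S" for I
  proof (rule pos)
    show "I \<in># B + C"
      using that in_diffD[of I B C] in_diffD[of I C B] unfolding S_def B'_def C'_def by auto
  qed
  define b where "b = Min (fst ` S)"
  have b: "\<And>I. I \<in> S \<Longrightarrow> b \<le> fst I" "b \<in> fst ` S"
    using \<open>S \<noteq> {}\<close> \<open>finite S\<close> by (auto simp: b_def)
  define d where "d = Max (snd ` {I \<in> S. fst I = b})"
  have "finite (snd ` {I \<in> S. fst I = b})" "snd ` {I \<in> S. fst I = b} \<noteq> {}"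
    using b(2) \<open>finite S\<close> by auto
  then have d_max: "\<And>I. I \<in> S \<Longrightarrow> fst I = b \<Longrightarrow> snd I \<le> d"
    and "d \<in> snd ` {I \<in> S. fst I = b}"
    unfolding d_def by (blast intro: Max_ge, blast intro: Max_in)
  then have d_in: "(b, d) \<in> S"
    by auto
  have bd: "0 \<le> b" "ereal b < d"
    using S_pos[OF d_in] by auto
  \<comment> \<open>The scale \<open>x\<close> lies strictly after \<open>b\<close>, since bars are
    open at their birth, but so close to \<open>b\<close> that no bar born later is alive at
    \<open>x\<close>.\<close>
  have "\<forall>I\<in>S. \<forall>\<^sub>F x in at_right b. fst I = b \<or> x \<le> fst I"
  proof
    fix I assume "I \<in> S"
    show "\<forall>\<^sub>F x in at_right b. fst I = b \<or> x \<le> fst I"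
    proof (cases "fst I = b")
      case False
      then have "b < fst I" using b(1)[OF \<open>I \<in> S\<close>] by simp
      then have "\<forall>\<^sub>F x in at_right b. x \<in> {b<..<fst I}"
        by (rule eventually_at_right_real)
      then show ?thesis by eventually_elim simp
    qed simp
  qed
  then have "\<forall>\<^sub>F x in at_right b. \<forall>I\<in>S. fst I = b \<or> x \<le> fst I"
    by (rule eventually_ball_finite[OF \<open>finite S\<close>])
  moreover have "\<forall>\<^sub>F x in at_right b. b < x \<and> ereal x \<le> d"
  proof -
    obtain e where e: "b < e" "ereal e < d"
      using ereal_dense2[OF bd(2)] by auto
    have "\<forall>\<^sub>F x in at_right b. x \<in> {b<..<e}"
      by (rule eventually_at_right_real[OF e(1)])
    then show ?thesis
      by eventually_elim (use e(2) in \<open>auto intro: order_trans[of _ "ereal e"] less_imp_le\<close>)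
  qed
  ultimately have "\<forall>\<^sub>F x in at_right b. (\<forall>I\<in>S. fst I = b \<or> x \<le> fst I) \<and> b < x \<and> ereal x \<le> d"
    by eventually_elim auto
  then obtain x where x: "\<forall>I\<in>S. fst I = b \<or> x \<le> fst I" "b < x" "ereal x \<le> d"
    using eventually_happens[of _ "at_right b"] by auto
  \<comment> \<open>The scale \<open>y\<close> separates \<open>d\<close> from all smaller deaths:
    \<open>d\<close> itself if it is finite, otherwise any number beyond \<open>x\<close> and the
    finite deaths.\<close>
  have "\<exists>y\<ge>x. ereal y \<le> d \<and> (\<forall>e\<in>snd ` S. e < d \<longrightarrow> e < ereal y)"
  proof (cases d)
    case (real r)
    then show ?thesis using x(3) by (intro exI[of _ r]) auto
  next
    case PInf
    have "\<forall>e\<in>snd ` S. \<forall>\<^sub>F y in at_top. e < d \<longrightarrow> e < ereal y"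
    proof
      fix e assume "e \<in> snd ` S"
      show "\<forall>\<^sub>F y in at_top. e < d \<longrightarrow> e < ereal y"
      proof (cases e)
        case (real r)
        then show ?thesis
          using eventually_gt_at_top[of r] by (auto elim: eventually_mono)
      qed (use PInf in auto)
    qed
    then have "\<forall>\<^sub>F y in at_top. \<forall>e\<in>snd ` S. e < d \<longrightarrow> e < ereal y"
      by (rule eventually_ball_finite[rotated]) (simp add: \<open>finite S\<close>)
    then have "\<forall>\<^sub>F y in at_top. (\<forall>e\<in>snd ` S. e < d \<longrightarrow> e < ereal y) \<and> x \<le> y"
      using eventually_ge_at_top[of x] by (rule eventually_conj)
    then have "\<exists>y. (\<forall>e\<in>snd ` S. e < d \<longrightarrow> e < ereal y) \<and> x \<le> y"
      by (rule eventually_happens'[OF trivial_limit_at_top_linorder])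
    then obtain y where "\<forall>e\<in>snd ` S. e < d \<longrightarrow> e < ereal y" "x \<le> y"
      by (elim exE conjE)
    then show ?thesis
      by (intro exI[of _ y]) (simp add: PInf)
  qed (use bd in auto)
  then obtain y where y: "x \<le> y" "ereal y \<le> d" "\<And>e. e \<in> snd ` S \<Longrightarrow> e < d \<Longrightarrow> e < ereal y"
    by blast
  have only: "I = (b, d)" if "I \<in> S" "fst I < x" "ereal y \<le> snd I" for I
  proof -
    have "fst I = b" using x(1) that by force
    moreover have "snd I = d"
      using d_max[OF that(1) calculation] y(3)[of "snd I"] that by force
    ultimately show ?thesis by (simp add: prod_eq_iff)
  qed
  have S_def': "S = set_mset B' \<union> set_mset C'" by (simp add: S_def)
  have pos: "count_over x y D \<noteq> 0 \<longleftrightarrow> (b, d) \<in># D" if "set_mset D \<subseteq> S" for D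
  proof -
    have "count_over x y D \<noteq> 0 \<longleftrightarrow> (\<exists>I\<in>#D. fst I < x \<and> ereal y \<le> snd I)"
      unfolding count_over_def size_eq_0_iff_empty filter_mset_eq_mempty_iff by blast
    also have "\<dots> \<longleftrightarrow> (b, d) \<in># D"
      using only[OF subsetD[OF that]] x(2) y(2) by (metis fst_conv snd_conv)
    finally show ?thesis .
  qed
  have "(b, d) \<in># B' \<longleftrightarrow> (b, d) \<in># C'"
    using pos[of B'] pos[of C'] eq'[of x y] x(2) y(1) bd(1) S_def' by simp
  then show False
    using disj d_in by (auto simp: S_def')
qed

theorem interval_decomposition_unique:
  assumes lin: "\<And>x. lin_closed (B x)"
    and mono: "\<And>x y. x \<le> y \<Longrightarrow> B x \<subseteq> B y"
    and dec: "interval_decomposition Z B bs z" "interval_decomposition Z B bs' z'"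
  shows "mset bs = mset bs'"
proof (rule barcode_eqI)
  show "0 \<le> fst I \<and> ereal (fst I) < snd I" if "I \<in># mset bs + mset bs'" for I
  proof -
    have "I \<in> set bs \<or> I \<in> set bs'"
      using that by simp
    then show ?thesis
      using interval_decompositionD(1)[OF dec(1)] interval_decompositionD(1)[OF dec(2)] by blast
  qed
  show "count_over x y (mset bs) = count_over x y (mset bs')" if "0 \<le> x" "x \<le> y" for x y
    using card_bars_over_le[of B, OF lin mono dec that] card_bars_over_le[of B, OF lin mono dec(2,1) that]
    by (simp add: card_bars_over)
qed

section \<open>Normal form of a filtered complex\<close>

definition unit_chain :: "'a \<Rightarrow> 'a \<Rightarrow> 'f::field" where
  "unit_chain s t = (if t = s then 1 else 0)"

text \<open>The number \<open>r s\<close> is the place of the cell \<open>s\<close> in a linear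
  order. Both \<open>deg\<close> and \<open>r\<close> are constrained only by the predicates below,
  so that one interpretation covers all orderings of the simplices. For simplices \<open>deg\<close>
  is the cardinality, that is the dimension plus one.\<close>

locale ranked_complex =
  fixes D :: "('a \<Rightarrow> 'f::field) \<Rightarrow> 'a \<Rightarrow> 'f" and deg r :: "'a \<Rightarrow> nat"
  assumes D_linear: "D (\<lambda>s. a * u s + b * v s) = (\<lambda>s. a * D u s + b * D v s)"
    and D_D: "D (D c) = (\<lambda>_. 0)"
begin

lemma D_zero: "D (\<lambda>_. 0) = (\<lambda>_. 0)"
  using D_linear[of 0 "\<lambda>_. 0" 0 "\<lambda>_. 0"] by simp

lemma D_sum: "D (\<lambda>t. \<Sum>s\<in>W. e s * b s t) = (\<lambda>t. \<Sum>s\<in>W. e s * D (b s) t)"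
proof (induction W rule: infinite_finite_induct)
  case (insert x W)
  then have "D (\<lambda>t. \<Sum>s\<in>insert x W. e s * b s t) =
      D (\<lambda>t. e x * b x t + 1 * (\<Sum>s\<in>W. e s * b s t))"
    by simp
  also have "\<dots> = (\<lambda>t. e x * D (b x) t + 1 * D (\<lambda>t. \<Sum>s\<in>W. e s * b s t) t)"
    by (rule D_linear)
  finally show ?case using insert by simp
qed (simp_all add: D_zero)

definition closed_cells :: "'a set \<Rightarrow> bool" where
  "closed_cells W \<longleftrightarrow> finite W \<and> inj_on r W \<and>
     (\<forall>s\<in>W. \<forall>t. D (unit_chain s) t \<noteq> 0 \<longrightarrow> t \<in> W \<and> deg s = Suc (deg t) \<and> r t < r s)"

text \<open>Triangularity: \<open>b s\<close> is a homogeneous chain whose last cell is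
  \<open>s\<close>. Hence \<open>b\<close> restricts to a basis of the chains on any set of cells
  that contains the supports of its basis chains, in particular on each sublevel complex of a
  filtration compatible with \<open>r\<close>.\<close>

definition adapted :: "'a set \<Rightarrow> ('a \<Rightarrow> 'a \<Rightarrow> 'f) \<Rightarrow> bool" where
  "adapted W b \<longleftrightarrow> finite W \<and> inj_on r W \<and>
     (\<forall>s\<in>W. b s s \<noteq> 0 \<and> (\<forall>t. b s t \<noteq> 0 \<longrightarrow> t \<in> W \<and> deg t = deg s \<and> r t \<le> r s))"

lemma adapted_finite: "adapted W b \<Longrightarrow> finite W"
  unfolding adapted_def by blast

lemma adapted_inj: "adapted W b \<Longrightarrow> s \<in> W \<Longrightarrow> t \<in> W \<Longrightarrow> r s = r t \<Longrightarrow> s = t"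
  unfolding adapted_def inj_on_def by blast

lemma adapted_diag: "adapted W b \<Longrightarrow> s \<in> W \<Longrightarrow> b s s \<noteq> 0"
  unfolding adapted_def by blast

lemma adapted_supp:
  "adapted W b \<Longrightarrow> s \<in> W \<Longrightarrow> b s t \<noteq> 0 \<Longrightarrow> t \<in> W \<and> deg t = deg s \<and> r t \<le> r s"
  unfolding adapted_def by blast

text \<open>Elimination from the last cell downwards: a multiple of \<open>b x\<close> clears the
  coefficient at the last cell \<open>x\<close> of \<open>W\<close>. Keeping \<open>W\<close>
  separate from \<open>V\<close> shows that a chain of a subcomplex is expanded by basis chains of
  that subcomplex.\<close>

lemma adapted_expansion:
  assumes ad: "adapted V b" and "W \<subseteq> V"
    and "\<And>s t. s \<in> W \<Longrightarrow> b s t \<noteq> 0 \<Longrightarrow> t \<in> W"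
    and "\<And>t. c t \<noteq> 0 \<Longrightarrow> t \<in> W"
  shows "\<exists>e. (\<forall>s. e s \<noteq> 0 \<longrightarrow> s \<in> W) \<and> c = (\<lambda>t. \<Sum>s\<in>V. e s * b s t)"
proof -
  have "finite W"
    using ad \<open>W \<subseteq> V\<close> finite_subset adapted_finite by blast
  then show ?thesis
    using assms(2-4)
  proof (induction W arbitrary: c rule: finite_ranking_induct[where f = r])
    case empty
    then have "c = (\<lambda>_. 0)" by auto
    then show ?case by (intro exI[of _ "\<lambda>_. 0"]) simp
  next
    case (insert x W)
    show ?case
    proof (cases "x \<in> W")
      case True
      then show ?thesis using insert by (simp add: insert_absorb)
    next
      case False
      have xV: "x \<in> V" "b x x \<noteq> 0"
        using insert.prems(1) adapted_diag[OF ad] by auto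
      define k where "k = c x / b x x"
      define c' where "c' = (\<lambda>t. c t - k * b x t)"
      \<comment> \<open>An earlier basis chain cannot involve \<open>x\<close>, because
        \<open>x\<close> has the highest rank.\<close>
      have closed: "t \<in> W" if "s \<in> W" "b s t \<noteq> 0" for s t
      proof -
        have "t \<in> insert x W" using insert.prems(2) that by blast
        moreover have "t \<noteq> x"
        proof
          assume "t = x"
          then have "r x = r s"
            using adapted_supp[OF ad _ that(2)] insert.prems(1) insert.hyps(2)[OF that(1)] that(1)
            by (metis insert_subset le_antisym subsetD)
          then have "x = s"
            using adapted_inj[OF ad] insert.prems(1) that(1) by blast
          with False that(1) show False by blast
        qed
        ultimately show ?thesis by blast
      qed
      have c': "t \<in> W" if "c' t \<noteq> 0" for t
      proof -
        have "c t \<noteq> 0 \<or> b x t \<noteq> 0"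
          using that by (auto simp: c'_def)
        then have "t \<in> insert x W"
          using insert.prems(2,3) by blast
        moreover have "t \<noteq> x"
          using that xV(2) by (auto simp: c'_def k_def)
        ultimately show ?thesis by blast
      qed
      have "\<exists>e. (\<forall>s. e s \<noteq> 0 \<longrightarrow> s \<in> W) \<and> c' = (\<lambda>t. \<Sum>s\<in>V. e s * b s t)"
        by (rule insert.IH) (use insert.prems(1) closed c' in auto)
      then obtain e where e: "\<forall>s. e s \<noteq> 0 \<longrightarrow> s \<in> W" "c' = (\<lambda>t. \<Sum>s\<in>V. e s * b s t)"
        by (elim exE conjE)
      define e' where "e' = e(x := k)"
      have "e x = 0" using e(1) False by blast
      have "c t = (\<Sum>s\<in>V. e' s * b s t)" for t
      proof -
        have "(\<Sum>s\<in>V. e' s * b s t) = k * b x t + (\<Sum>s\<in>V - {x}. e s * b s t)"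
          using xV(1) adapted_finite[OF ad] by (simp add: sum.remove[of V x] e'_def)
        also have "(\<Sum>s\<in>V - {x}. e s * b s t) = (\<Sum>s\<in>V. e s * b s t)"
          using xV(1) adapted_finite[OF ad] \<open>e x = 0\<close> by (simp add: sum.remove[of V x])
        also have "\<dots> = c' t" using e(2) by simp
        finally show ?thesis by (simp add: c'_def)
      qed
      then show ?thesis
        using e(1) by (intro exI[of _ e']) (auto simp: e'_def)
    qed
  qed
qed

text \<open>No other term reaches the cell \<open>m\<close>: a basis chain of lower rank ends before
  \<open>m\<close>, and one of higher rank has coefficient 0.\<close>

lemma adapted_leading:
  assumes ad: "adapted W b" and m: "m \<in> W" "\<And>s. s \<in> W \<Longrightarrow> e s \<noteq> 0 \<Longrightarrow> r s \<le> r m"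
  shows "(\<Sum>s\<in>W. e s * b s m) = e m * b m m"
proof -
  have "e s * b s m = 0" if s: "s \<in> W - {m}" for s
  proof (rule ccontr)
    assume *: "e s * b s m \<noteq> 0"
    then have "r m \<le> r s"
      using adapted_supp[OF ad, of s m] s by simp
    moreover have "r s \<le> r m"
      using m(2)[of s] s * by simp
    ultimately have "s = m"
      using adapted_inj[OF ad, of s m] s m(1) by simp
    with s show False by simp
  qed
  then have "(\<Sum>s\<in>W - {m}. e s * b s m) = 0"
    by (rule sum.neutral[rule_format])
  then show ?thesis
    using m(1) adapted_finite[OF ad] by (simp add: sum.remove[of W m])
qed

lemma finite_rank_max:
  assumes "finite G" "G \<noteq> {}"
  shows "\<exists>m\<in>G. \<forall>s\<in>G. r s \<le> r m"
proof -
  have "Max (r ` G) \<in> r ` G"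
    using assms by (intro Max_in) auto
  then obtain m where "m \<in> G" "r m = Max (r ` G)"
    by auto
  then show ?thesis
    using assms(1) by (intro bexI[of _ m]) auto
qed

text \<open>The contribution at the last cell with a nonzero coefficient cannot cancel.\<close>

lemma adapted_independent:
  assumes ad: "adapted W b" and 0: "\<And>t. (\<Sum>s\<in>W. e s * b s t) = 0" and "s \<in> W"
  shows "e s = 0"
proof (rule ccontr)
  define G where "G = {s \<in> W. e s \<noteq> 0}"
  assume "e s \<noteq> 0"
  then have "finite G" "G \<noteq> {}"
    using \<open>s \<in> W\<close> adapted_finite[OF ad] by (auto simp: G_def)
  then obtain m where m: "m \<in> G" "\<forall>s\<in>G. r s \<le> r m"
    using finite_rank_max[of G] by blast
  have "(\<Sum>s\<in>W. e s * b s m) = e m * b m m"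
    by (rule adapted_leading[OF ad]) (use m in \<open>auto simp: G_def\<close>)
  moreover have "e m \<noteq> 0" "m \<in> W"
    using m(1) by (auto simp: G_def)
  ultimately show False
    using 0[of m] adapted_diag[OF ad, of m] by simp
qed

text \<open>The set \<open>F\<close> holds the cells whose classes eventually die, and
  \<open>q s\<close> is the cell that kills the class of \<open>s\<close>. Cells outside
  \<open>F\<close> and its image under \<open>q\<close> carry the classes that live forever.\<close>

definition normal_form :: "'a set \<Rightarrow> ('a \<Rightarrow> 'a \<Rightarrow> 'f) \<Rightarrow> 'a set \<Rightarrow> ('a \<Rightarrow> 'a) \<Rightarrow> bool" where
  "normal_form W b F q \<longleftrightarrow> adapted W b \<and> F \<subseteq> W \<and> inj_on q F \<and> F \<inter> q ` F = {} \<and>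
     (\<forall>s\<in>F. q s \<in> W \<and> D (b (q s)) = b s \<and> deg (q s) = Suc (deg s) \<and> r s < r (q s)) \<and>
     (\<forall>s\<in>W. s \<notin> q ` F \<longrightarrow> D (b s) = (\<lambda>_. 0))"

lemma normal_formD:
  assumes "normal_form W b F q"
  shows "adapted W b" "F \<subseteq> W" "inj_on q F" "F \<inter> q ` F = {}"
    and "\<And>s. s \<in> F \<Longrightarrow> q s \<in> W" "\<And>s. s \<in> F \<Longrightarrow> D (b (q s)) = b s"
    and "\<And>s. s \<in> F \<Longrightarrow> deg (q s) = Suc (deg s)" "\<And>s. s \<in> F \<Longrightarrow> r s < r (q s)"
    and "\<And>s. s \<in> W \<Longrightarrow> s \<notin> q ` F \<Longrightarrow> D (b s) = (\<lambda>_. 0)"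
  using assms by (simp_all add: normal_form_def)

lemma normal_form_D:
  assumes nf: "normal_form W b F q"
  shows "D (\<lambda>t. \<Sum>s\<in>W. e s * b s t) = (\<lambda>t. \<Sum>s\<in>F. e (q s) * b s t)"
proof
  fix t
  note N = normal_formD[OF nf]
  have "(\<Sum>s\<in>W. e s * D (b s) t) = (\<Sum>s\<in>q ` F. e s * D (b s) t)"
  proof (rule sum.mono_neutral_right)
    show "finite W" by (rule adapted_finite[OF N(1)])
    show "q ` F \<subseteq> W" using N(5) by blast
    show "\<forall>s\<in>W - q ` F. e s * D (b s) t = 0"
    proof
      fix s assume "s \<in> W - q ` F"
      then show "e s * D (b s) t = 0"
        using fun_cong[OF N(9), of s t] by simp
    qed
  qed
  also have "\<dots> = (\<Sum>s\<in>F. e (q s) * D (b (q s)) t)"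
    using N(3) by (simp add: sum.reindex)
  also have "\<dots> = (\<Sum>s\<in>F. e (q s) * b s t)"
    using N(6) by (intro sum.cong) auto
  finally show "D (\<lambda>t. \<Sum>s\<in>W. e s * b s t) t = (\<Sum>s\<in>F. e (q s) * b s t)"
    by (simp add: D_sum)
qed

lemma normal_form_sum_extend:
  assumes nf: "normal_form W b F q"
  shows "(\<Sum>s\<in>F. e s * b s t) = (\<Sum>s\<in>W. (if s \<in> F then e s else 0) * b s t)"
  using normal_formD(2)[OF nf] adapted_finite[OF normal_formD(1)[OF nf]]
  by (intro sum.mono_neutral_cong_left) auto

text \<open>The boundaries of the killing chains are distinct basis chains and therefore
  independent, so a cycle has no component along a killing chain.\<close>

lemma normal_form_cycle:
  assumes nf: "normal_form W b F q"
    and 0: "D (\<lambda>t. \<Sum>s\<in>W. e s * b s t) = (\<lambda>_. 0)" and "s \<in> F"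
  shows "e (q s) = 0"
proof -
  have "(\<Sum>s\<in>W. (if s \<in> F then e (q s) else 0) * b s t) = 0" for t
    using fun_cong[OF 0, of t] normal_form_sum_extend[OF nf, of "\<lambda>s. e (q s)" t]
    by (simp add: normal_form_D[OF nf])
  from adapted_independent[OF normal_formD(1)[OF nf] this, of s] show ?thesis
    using normal_formD(2)[OF nf] \<open>s \<in> F\<close> by auto
qed

text \<open>The new column is reduced by those basis chains whose boundaries are already basis chains.
  If its boundary does not become 0, it kills the basis chain of the youngest remaining cell,
  which is then replaced by this boundary.\<close>

lemma normal_form_insert:
  assumes nf: "normal_form S b F q" and "x \<notin> S" and max: "\<And>s. s \<in> S \<Longrightarrow> r s < r x"
    and cl: "closed_cells (insert x S)"
  shows "\<exists>b F q. normal_form (insert x S) b F q"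
proof -
  note N = normal_formD[OF nf]
  note ad = N(1)
  have fin: "finite S" by (rule adapted_finite[OF ad])
  have inj: "inj_on r (insert x S)"
    using cl unfolding closed_cells_def by (elim conjE)
  define u where "u = D (unit_chain x)"
  define T where "T = {t \<in> S. deg x = Suc (deg t)}"
  have uT: "t \<in> T" if "u t \<noteq> 0" for t
    using cl that unfolding closed_cells_def u_def T_def by blast
  have T_closed: "t \<in> T" if "s \<in> T" "b s t \<noteq> 0" for s t
    using adapted_supp[OF ad _ that(2)] that(1) unfolding T_def by fastforce
  have "T \<subseteq> S" by (auto simp: T_def)
  have "\<exists>e. (\<forall>s. e s \<noteq> 0 \<longrightarrow> s \<in> T) \<and> u = (\<lambda>t. \<Sum>s\<in>S. e s * b s t)"
    by (rule adapted_expansion[OF ad \<open>T \<subseteq> S\<close>]) (blast intro: T_closed uT)+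
  then obtain e where e: "\<forall>s. e s \<noteq> 0 \<longrightarrow> s \<in> T" and u: "u = (\<lambda>t. \<Sum>s\<in>S. e s * b s t)"
    by (elim exE conjE)
  note e = e[rule_format]
  \<comment> \<open>As a boundary, \<open>u\<close> is a cycle. This is what later keeps the
    youngest remaining cell \<open>m\<close> out of the image of \<open>q\<close>.\<close>
  have e_q: "e (q s) = 0" if "s \<in> F" for s
    using normal_form_cycle[OF nf _ that, of e] D_D[of "unit_chain x"] by (simp flip: u add: u_def)
  \<comment> \<open>The boundary of \<open>b (q s)\<close> is \<open>b s\<close>, so this correction
    deletes exactly the \<open>F\<close>-part of the boundary of \<open>x\<close>.\<close>
  define y where "y = (\<lambda>t. 1 * unit_chain x t + (-1) * (\<Sum>s\<in>F. e s * b (q s) t))"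
  define e' where "e' = (\<lambda>s. if s \<in> F then 0 else e s)"
  have Dy: "D y = (\<lambda>t. \<Sum>s\<in>S. e' s * b s t)"
  proof
    fix t
    have "D y t = u t - (\<Sum>s\<in>F. e s * D (b (q s)) t)"
      unfolding y_def D_linear by (simp add: u_def D_sum)
    also have "(\<Sum>s\<in>F. e s * D (b (q s)) t) = (\<Sum>s\<in>F. e s * b s t)"
      using N(6) by (intro sum.cong) auto
    also have "\<dots> = (\<Sum>s\<in>S. (if s \<in> F then e s else 0) * b s t)"
      by (rule normal_form_sum_extend[OF nf])
    also have "u t - \<dots> = (\<Sum>s\<in>S. e' s * b s t)"
      unfolding u sum_subtractf[symmetric] by (intro sum.cong) (auto simp: e'_def)
    finally show "D y t = (\<Sum>s\<in>S. e' s * b s t)" .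
  qed
  have bq: "t \<in> S" "deg t = deg x" if "s \<in> F" "e s \<noteq> 0" "b (q s) t \<noteq> 0" for s t
    using adapted_supp[OF ad N(5)[OF that(1)] that(3)] e[OF that(2)] N(7)[OF that(1)]
    unfolding T_def by fastforce+
  have y_x: "y x \<noteq> 0"
  proof -
    have "(\<Sum>s\<in>F. e s * b (q s) x) = 0"
      using bq(1)[of _ x] \<open>x \<notin> S\<close> by (intro sum.neutral) auto
    then show ?thesis by (simp add: y_def unit_chain_def)
  qed
  have y_supp: "t \<in> insert x S \<and> deg t = deg x \<and> r t \<le> r x" if "y t \<noteq> 0" for t
  proof (cases "t = x")
    case False
    then have "(\<Sum>s\<in>F. e s * b (q s) t) \<noteq> 0"
      using that by (auto simp: y_def unit_chain_def)
    then obtain s where "s \<in> F" "e s * b (q s) t \<noteq> 0"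
      by (meson sum.neutral)
    then show ?thesis
      using bq[of s t] max[of t] by fastforce
  qed simp
  have F_x: "q s \<noteq> x" "s \<noteq> x" if "s \<in> F" for s
    using N(5)[OF that] N(2) that \<open>x \<notin> S\<close> by auto
  have ad_I: "adapted (insert x S) c"
    if "\<And>s. s \<in> insert x S \<Longrightarrow> c s s \<noteq> 0 \<and>
      (\<forall>t. c s t \<noteq> 0 \<longrightarrow> t \<in> insert x S \<and> deg t = deg s \<and> r t \<le> r s)" for c
    unfolding adapted_def using fin inj that by blast
  define G where "G = {s \<in> S. e' s \<noteq> 0}"
  show ?thesis
  proof (cases "G = {}")
    case True
    then have "D y = (\<lambda>_. 0)"
      unfolding Dy by (auto simp: G_def intro!: sum.neutral)
    moreover have "adapted (insert x S) (b(x := y))"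
      using ad_I[of "b(x := y)"] y_x y_supp adapted_diag[OF ad] adapted_supp[OF ad] \<open>x \<notin> S\<close>
      by (metis fun_upd_apply insert_iff)
    ultimately have "normal_form (insert x S) (b(x := y)) F q"
      unfolding normal_form_def using N(2-9) F_x by auto
    then show ?thesis by blast
  next
    case False
    moreover have "finite G"
      using fin by (simp add: G_def)
    ultimately obtain m where m: "m \<in> G" "\<forall>s\<in>G. r s \<le> r m"
      using finite_rank_max[of G] by blast
    have mS: "m \<in> S" "e' m \<noteq> 0" "m \<notin> F" "m \<in> T" "m \<noteq> x"
      using m(1) e[of m] \<open>x \<notin> S\<close> by (auto simp: G_def e'_def split: if_splits)
    have mq: "m \<notin> q ` F"
      using e_q mS(2) by (auto simp: e'_def split: if_splits)
    have "D y m = e' m * b m m"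
      unfolding Dy by (rule adapted_leading[OF ad mS(1)]) (use m(2) in \<open>auto simp: G_def\<close>)
    then have w_m: "D y m \<noteq> 0"
      using mS(2) adapted_diag[OF ad mS(1)] by simp
    have w_supp: "t \<in> S \<and> deg t = deg m \<and> r t \<le> r m" if t: "D y t \<noteq> 0" for t
    proof -
      obtain s where s: "s \<in> S" "e' s * b s t \<noteq> 0"
        using t unfolding Dy by (meson sum.neutral)
      then have "s \<in> G" "s \<in> T"
        using e[of s] by (auto simp: G_def e'_def split: if_splits)
      then show ?thesis
        using adapted_supp[OF ad s(1), of t] s(2) bspec[OF m(2), of s] mS(4) unfolding T_def
        by (metis (mono_tags, lifting) Suc_inject mem_Collect_eq mult_zero_right order_trans)
    qed
    \<comment> \<open>Since \<open>m\<close> is the last cell of \<open>D y\<close>, putting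
      \<open>D y\<close> in the place of \<open>b m\<close> preserves triangularity.\<close>
    define b' where "b' = b(x := y, m := D y)"
    define q' where "q' = q(m := x)"
    have b': "b' x = y" "b' m = D y" "\<And>s. s \<noteq> x \<Longrightarrow> s \<noteq> m \<Longrightarrow> b' s = b s"
      using mS(5) by (auto simp: b'_def)
    have q': "q' m = x" "\<And>s. s \<in> F \<Longrightarrow> q' s = q s"
      using mS(3) by (auto simp: q'_def)
    have q'F: "q' ` insert m F = insert x (q ` F)"
      using q' by auto
    have "adapted (insert x S) b'"
    proof (rule ad_I)
      fix s assume "s \<in> insert x S"
      then consider "s = x" | "s = m" | "s \<in> S" "s \<noteq> x" "s \<noteq> m" by blast
      then show "b' s s \<noteq> 0 \<and>
          (\<forall>t. b' s t \<noteq> 0 \<longrightarrow> t \<in> insert x S \<and> deg t = deg s \<and> r t \<le> r s)"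
      proof cases
        case 1
        show ?thesis unfolding 1 b'(1) using y_x y_supp by blast
      next
        case 2
        show ?thesis unfolding 2 b'(2) using w_m w_supp by blast
      next
        case 3
        show ?thesis
          unfolding b'(3)[OF 3(2,3)] using adapted_diag[OF ad 3(1)] adapted_supp[OF ad 3(1)] by blast
      qed
    qed
    moreover have "inj_on q' (insert m F)"
    proof -
      have "inj_on q' F"
        using N(3) q'(2) by (simp cong: inj_on_cong)
      moreover have "q' m \<notin> q' ` (F - {m})"
        using q' F_x(1) by force
      ultimately show ?thesis by simp
    qed
    moreover have "insert m F \<inter> q' ` insert m F = {}"
      unfolding q'F using N(4) mq mS(5) F_x(2) by blast
    moreover have "q' s \<in> insert x S \<and> D (b' (q' s)) = b' s \<and> deg (q' s) = Suc (deg s) \<and>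
        r s < r (q' s)" if "s \<in> insert m F" for s
    proof (cases "s = m")
      case True
      then show ?thesis
        using q'(1) b'(1,2) mS(1,4) max[of m] by (auto simp: T_def)
    next
      case False
      then have "s \<in> F" using that by blast
      moreover have "q s \<noteq> m" using mq \<open>s \<in> F\<close> by blast
      ultimately show ?thesis
        using q'(2) b'(3) F_x N(5-8) False by simp
    qed
    moreover have "D (b' s) = (\<lambda>_. 0)" if "s \<in> insert x S" "s \<notin> q' ` insert m F" for s
      using that b' N(9)[of s] D_D unfolding q'F by (cases "s = m") auto
    ultimately have "normal_form (insert x S) b' (insert m F) q'"
      unfolding normal_form_def using N(2) mS(1) by blast
    then show ?thesis by blast
  qed
qed

text \<open>Cells are inserted by increasing rank. Every initial segment is again closed under
  boundaries, because faces have smaller rank than the cell.\<close>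

theorem normal_form_exists:
  assumes "closed_cells W"
  shows "\<exists>b F q. normal_form W b F q"
proof -
  have "finite W" using assms unfolding closed_cells_def by blast
  then show ?thesis
    using assms
  proof (induction W rule: finite_ranking_induct[where f = r])
    case empty
    then show ?case by (auto simp: normal_form_def adapted_def)
  next
    case (insert x S)
    show ?case
    proof (cases "x \<in> S")
      case True
      then show ?thesis using insert by (simp add: insert_absorb)
    next
      case False
      have less: "r s < r x" if "s \<in> S" for s
        using insert.hyps(2)[OF that] insert.prems False that
        by (metis closed_cells_def inj_on_def insertCI order_le_imp_less_or_eq)
      have "closed_cells S"
        unfolding closed_cells_def
      proof (intro conjI ballI allI impI)
        fix s t assume st: "s \<in> S" "D (unit_chain s) t \<noteq> 0"
        then have *: "t \<in> insert x S" "deg s = Suc (deg t)" "r t < r s"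
          using insert.prems unfolding closed_cells_def by blast+
        then show "t \<in> S" "deg s = Suc (deg t)" "r t < r s"
          using less[OF st(1)] by auto
      next
        show "finite S" by (rule insert.hyps(1))
        show "inj_on r S"
          using insert.prems unfolding closed_cells_def by (meson inj_on_subset subset_insertI)
      qed
      then obtain b F q where "normal_form S b F q"
        using insert.IH by blast
      then show ?thesis
        using normal_form_insert[OF _ False less insert.prems] by blast
    qed
  qed
qed

end

section \<open>Barcodes of filtered simplicial complexes\<close>

definition simplices :: "nat \<Rightarrow> nat set set" where
  "simplices n = {s. s \<subseteq> {..<n} \<and> s \<noteq> {}}"

definition sublevel :: "nat \<Rightarrow> (nat set \<Rightarrow> real) \<Rightarrow> real \<Rightarrow> nat set set" where
  "sublevel n f x = {s \<in> simplices n. f s < x}"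

text \<open>Nonnegative values are required because interval decompositions see only the scales from
  0 on and demand nonnegative births.\<close>

definition filtration :: "nat \<Rightarrow> (nat set \<Rightarrow> real) \<Rightarrow> bool" where
  "filtration n f \<longleftrightarrow> (\<forall>s\<in>simplices n. 0 \<le> f s) \<and>
     (\<forall>s\<in>simplices n. \<forall>t\<in>simplices n. t \<subseteq> s \<longrightarrow> f t \<le> f s)"

lemma finite_simplices: "finite (simplices n)"
  by (rule finite_subset[of _ "Pow {..<n}"]) (auto simp: simplices_def)

lemma boundary_map_linear:
  "boundary_map n (\<lambda>s. a * u s + b * v s) =
     (\<lambda>s. a * boundary_map n u s + b * boundary_map n v s)"
  by (rule ext) (simp add: boundary_map_def sum.distrib sum_distrib_left algebra_simps)

text \<open>One of the two triangles of index pairs is reindexed and cancels the other. That the sum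
  equals its own negative would not suffice in characteristic 2.\<close>

lemma sum_antisymmetric_pairs:
  fixes g :: "'i::linorder \<Rightarrow> 'i \<Rightarrow> 'f::ab_group_add"
  assumes "finite A" and anti: "\<And>u v. u \<in> A \<Longrightarrow> v \<in> A \<Longrightarrow> u < v \<Longrightarrow> g u v = - g v u"
  shows "(\<Sum>v\<in>A. \<Sum>u\<in>A - {v}. g v u) = 0"
proof -
  have "(\<Sum>v\<in>A. \<Sum>u\<in>A - {v}. g v u) =
      (\<Sum>v\<in>A. (\<Sum>u\<in>{u \<in> A. u < v}. g v u) + (\<Sum>u\<in>{u \<in> A. v < u}. g v u))"
  proof (rule sum.cong)
    fix v assume "v \<in> A"
    have "A - {v} = {u \<in> A. u < v} \<union> {u \<in> A. v < u}" by auto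
    moreover have "{u \<in> A. u < v} \<inter> {u \<in> A. v < u} = {}" by auto
    ultimately show "(\<Sum>u\<in>A - {v}. g v u) =
        (\<Sum>u\<in>{u \<in> A. u < v}. g v u) + (\<Sum>u\<in>{u \<in> A. v < u}. g v u)"
      using assms(1) by (simp add: sum.union_disjoint)
  qed simp
  also have "\<dots> = (\<Sum>v\<in>A. \<Sum>u\<in>{u \<in> A. u < v}. g v u) + (\<Sum>v\<in>A. \<Sum>u\<in>{u \<in> A. v < u}. g v u)"
    by (rule sum.distrib)
  also have "(\<Sum>v\<in>A. \<Sum>u\<in>{u \<in> A. v < u}. g v u) = (\<Sum>u\<in>A. \<Sum>v\<in>{v \<in> A. v < u}. g v u)"
    by (rule sum.swap_restrict) (use assms(1) in auto)
  also have "\<dots> = - (\<Sum>v\<in>A. \<Sum>u\<in>{u \<in> A. u < v}. g v u)"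
    unfolding sum_negf[symmetric] by (intro sum.cong) (use anti in auto)
  finally show ?thesis by simp
qed

lemma boundary_boundary: "boundary_map n (boundary_map n c) = (\<lambda>_. 0)"
proof
  fix w
  show "boundary_map n (boundary_map n c) w = 0"
  proof (cases "w = {}")
    case False
    define A where "A = {..<n} - w"
    define \<kappa> where "\<kappa> = (\<lambda>v. card {u \<in> w. u < v})"
    define g where "g = (\<lambda>v u. (-1) ^ \<kappa> v *
        ((-1) ^ card {x \<in> insert v w. x < u} * c (insert u (insert v w))))"
    \<comment> \<open>Inserting \<open>v\<close> shifts the position of \<open>u\<close> exactly if
      \<open>v < u\<close>, so the two orders of inserting a pair of vertices carry opposite
      signs.\<close>
    have sgn: "card {x \<in> insert v w. x < u} = \<kappa> u + (if v < u then 1 else 0)" if "v \<in> A" for u v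
    proof -
      have "{x \<in> insert v w. x < u} =
          (if v < u then insert v {x \<in> w. x < u} else {x \<in> w. x < u})"
        by auto
      then show ?thesis using that by (simp add: \<kappa>_def A_def)
    qed
    have "boundary_map n (boundary_map n c) w = (\<Sum>v\<in>A. \<Sum>u\<in>A - {v}. g v u)"
    proof -
      have "A - {v} = {..<n} - insert v w" for v by (auto simp: A_def)
      then show ?thesis
        using False by (simp add: boundary_map_def g_def \<kappa>_def sum_distrib_left A_def[symmetric])
    qed
    also have "\<dots> = 0"
    proof (rule sum_antisymmetric_pairs)
      show "g u v = - g v u" if "u \<in> A" "v \<in> A" "u < v" for u v
        using that unfolding g_def sgn[OF that(1)] sgn[OF that(2)]
        by (simp add: insert_commute mult.left_commute)
    qed (simp add: A_def)
    finally show ?thesis .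
  qed (simp add: boundary_map_def)
qed

lemma boundary_unit_chain:
  assumes "boundary_map n (unit_chain s) t \<noteq> (0::'f::field)"
  shows "t \<noteq> {} \<and> (\<exists>v. v \<notin> t \<and> s = insert v t)"
proof -
  have "t \<noteq> {}" using assms by (auto simp: boundary_map_def)
  then have "(\<Sum>v\<in>{..<n} - t. (-1) ^ card {u \<in> t. u < v} * unit_chain s (insert v t)) \<noteq> (0::'f)"
    using assms by (simp add: boundary_map_def)
  then obtain v where "v \<in> {..<n} - t" "(-1) ^ card {u \<in> t. u < v} * unit_chain s (insert v t) \<noteq> (0::'f)"
    by (rule sum.not_neutral_contains_not_neutral)
  then show ?thesis
    using \<open>t \<noteq> {}\<close> by (auto simp: unit_chain_def split: if_splits)
qed

interpretation boundary: ranked_complex "boundary_map n" card r for n r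
  by unfold_locales (rule boundary_map_linear boundary_boundary)+


lemma lin_closed_boundaries: "lin_closed (boundaries n X q)"
  unfolding lin_closed_def
proof (intro conjI ballI allI)
  have 0: "boundary_map n (\<lambda>_. 0) = (\<lambda>_. 0 :: 'a)"
    by (auto simp: boundary_map_def)
  have "boundary_map n (\<lambda>_. 0) \<in> boundary_map n ` (chains X (Suc q) :: (nat set \<Rightarrow> 'a) set)"
    by (rule imageI) (simp add: chains_def)
  then show "(\<lambda>_. 0 :: 'a) \<in> boundaries n X q"
    unfolding boundaries_def 0 .
next
  fix u v :: "nat set \<Rightarrow> 'a" and a b
  assume "u \<in> boundaries n X q" "v \<in> boundaries n X q"
  then obtain c d where cd: "u = boundary_map n c" "v = boundary_map n d"
      "c \<in> chains X (Suc q)" "d \<in> chains X (Suc q)"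
    unfolding boundaries_def by (elim imageE)
  have "(\<lambda>s. a * c s + b * d s) \<in> chains X (Suc q)"
    unfolding chains_def
  proof (intro CollectI allI impI)
    fix s assume "a * c s + b * d s \<noteq> 0"
    then have "c s \<noteq> 0 \<or> d s \<noteq> 0" by auto
    then show "s \<in> X \<and> card s = Suc (Suc q)"
      using cd(3,4) unfolding chains_def by blast
  qed
  then show "(\<lambda>s. a * u s + b * v s) \<in> boundaries n X q"
    unfolding cd(1,2) boundary_map_linear[symmetric] boundaries_def by (rule imageI)
qed

lemma boundaries_mono: "X \<subseteq> Y \<Longrightarrow> boundaries n X q \<subseteq> boundaries n Y q"
  unfolding boundaries_def chains_def by (intro image_mono) auto

section \<open>Bars read off from a pairing of simplices\<close>

definition death :: "nat set set \<Rightarrow> (nat set \<Rightarrow> nat set) \<Rightarrow> (nat set \<Rightarrow> real) \<Rightarrow> nat set \<Rightarrow> ereal" where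
  "death F p f s = (if s \<in> F then ereal (f (p s)) else \<infinity>)"

text \<open>In persistence terminology a positive simplex creates a homology class, whereas the
  simplices in the image of \<open>p\<close> destroy one.\<close>

definition positive_simplices ::
  "nat \<Rightarrow> nat \<Rightarrow> nat set set \<Rightarrow> (nat set \<Rightarrow> nat set) \<Rightarrow> nat set set" where
  "positive_simplices q n F p = {s \<in> simplices n. card s = Suc q \<and> s \<notin> p ` F}"

text \<open>Pairs that enter at the same scale give empty bars and are dropped. The pairing is an
  argument separate from \<open>f\<close>, so that one pairing can be evaluated on two
  filtrations.\<close>

definition paired_barcode ::
  "nat \<Rightarrow> nat \<Rightarrow> nat set set \<Rightarrow> (nat set \<Rightarrow> nat set) \<Rightarrow> (nat set \<Rightarrow> real) \<Rightarrow> bar multiset" where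
  "paired_barcode q n F p f = image_mset (\<lambda>s. (f s, death F p f s))
     (filter_mset (\<lambda>s. ereal (f s) < death F p f s) (mset_set (positive_simplices q n F p)))"

text \<open>The ordering is compatible with \<open>f\<close>, so the basis of the normal form
  restricts to every sublevel complex. There the cycles are spanned by the basis chains of positive
  simplices, and the boundaries by those whose killer has already entered.\<close>

lemma interval_decomposition_paired:
  fixes b :: "nat set \<Rightarrow> nat set \<Rightarrow> 'f::field"
  assumes nf: "boundary.normal_form n r (simplices n) b F p"
    and compat: "\<And>s t. s \<in> simplices n \<Longrightarrow> t \<in> simplices n \<Longrightarrow> r t \<le> r s \<Longrightarrow> f t \<le> f s"
    and filt: "filtration n f"
  shows "\<exists>bs z. paired_barcode q n F p f = mset bs \<and>
    interval_decomposition (\<lambda>x. cycles n (sublevel n f x) q)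
      (\<lambda>x. boundaries n (sublevel n f x) q :: (nat set \<Rightarrow> 'f) set) bs z"
proof -
  define V where "V = simplices n"
  note N = boundary.normal_formD[OF nf, folded V_def]
  note ad = N(1)
  have finV: "finite V" by (simp add: V_def finite_simplices)
  define W where "W = (\<lambda>x k. {s \<in> V. f s < x \<and> card s = Suc k})"
  have chains_iff: "c \<in> chains (sublevel n f x) k \<longleftrightarrow> (\<forall>s. c s \<noteq> 0 \<longrightarrow> s \<in> W x k)"
    for c :: "nat set \<Rightarrow> 'f" and x k
    unfolding chains_def sublevel_def W_def V_def by blast
  have W_closed: "t \<in> W x k" if "s \<in> W x k" "b s t \<noteq> 0" for s t x k
  proof -
    have "s \<in> V" using that(1) by (simp add: W_def)
    from boundary.adapted_supp[OF ad this that(2)]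
    have t: "t \<in> V" "card t = card s" "r t \<le> r s" by blast+
    then have "f t \<le> f s"
      using compat[of s t] \<open>s \<in> V\<close> by (simp add: V_def)
    with that(1) t show ?thesis by (simp add: W_def)
  qed
  have W_V: "W x k \<subseteq> V" for x k by (auto simp: W_def)
  have expand: "\<exists>e. (\<forall>s. e s \<noteq> 0 \<longrightarrow> s \<in> W x k) \<and> c = (\<lambda>t. \<Sum>s\<in>V. e s * b s t)"
    if "c \<in> chains (sublevel n f x) k" for c x k
  proof (rule boundary.adapted_expansion[OF ad W_V])
    show "t \<in> W x k" if "s \<in> W x k" "b s t \<noteq> 0" for s t
      using that by (rule W_closed)
    show "t \<in> W x k" if "c t \<noteq> 0" for t
      using \<open>c \<in> chains (sublevel n f x) k\<close> that by (simp add: chains_iff)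
  qed
  have b_chain: "b s \<in> chains (sublevel n f x) k" if "s \<in> W x k" for s x k
    unfolding chains_iff by (intro allI impI) (rule W_closed[OF that])
  define dth where "dth = death F p f"
  define Q where "Q = {s \<in> positive_simplices q n F p. ereal (f s) < dth s}"
  have Q: "s \<in> V" "card s = Suc q" "s \<notin> p ` F" "ereal (f s) < dth s" if "s \<in> Q" for s
    using that by (auto simp: Q_def positive_simplices_def V_def)
  have "finite Q"
    by (rule finite_subset[OF _ finV]) (auto intro: Q(1))
  from finite_distinct_list[OF this] obtain xs where xs: "set xs = Q" "distinct xs"
    by blast
  define bs where "bs = map (\<lambda>s. (f s, dth s)) xs"
  \<comment> \<open>The representative of a bar is the same at all scales, so the structure maps
    send living classes to one another on the nose.\<close>
  define z where "z = (\<lambda>i (x::real). b (xs ! i))"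
  define alive where "alive = (\<lambda>x. {i. i < length bs \<and> x \<in> bar_interval (bs ! i)})"
  define A where "A = (\<lambda>x. {s \<in> Q. f s < x \<and> ereal x \<le> dth s})"
  have alive_bij: "bij_betw ((!) xs) (alive x) (A x)" for x
  proof -
    have eq: "alive x = {i. i < length xs \<and> xs ! i \<in> A x}"
      using nth_mem[of _ xs] xs(1) by (auto simp: alive_def bs_def A_def bar_interval_def)
    have "inj_on ((!) xs) (alive x)"
      unfolding eq using xs(2) by (auto simp: inj_on_def nth_eq_iff_index_eq)
    moreover have "(!) xs ` alive x = A x"
    proof
      show "A x \<subseteq> (!) xs ` alive x"
      proof
        fix s assume s: "s \<in> A x"
        then have "s \<in> set xs" by (simp add: xs(1) A_def)
        then obtain i where "i < length xs" "xs ! i = s" by (auto simp: in_set_conv_nth)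
        then show "s \<in> (!) xs ` alive x" using s unfolding eq by blast
      qed
    qed (auto simp: eq)
    ultimately show ?thesis by (simp add: bij_betw_def)
  qed
  have A_W: "A x \<subseteq> W x q" for x using Q by (auto simp: A_def W_def)
  have A_cycle: "boundary_map n (b s) = (\<lambda>_. 0)" if "s \<in> A x" for s x
    using N(9)[of s] Q(1,3)[of s] that by (simp add: A_def)
  have dead: "b s \<in> boundaries n (sublevel n f x) q" if "s \<in> F" "card s = Suc q" "f (p s) < x" for s x
  proof -
    have "p s \<in> W x (Suc q)"
      using N(5,7)[OF that(1)] that(2,3) by (simp add: W_def)
    then show ?thesis
      unfolding boundaries_def N(6)[OF that(1), symmetric] by (intro imageI b_chain)
  qed
  have lin: "lin_closed (boundaries n (sublevel n f x) q :: (nat set \<Rightarrow> 'f) set)" for x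
    by (rule lin_closed_boundaries)
  have extend: "(\<Sum>s\<in>A x. e s * b s t) = (\<Sum>s\<in>V. (if s \<in> A x then e s else 0) * b s t)" for e x t
    using A_W W_V finV by (intro sum.mono_neutral_cong_left) fastforce+
  have reindex: "(\<Sum>i\<in>alive x. e (xs ! i) * z i x t) = (\<Sum>s\<in>A x. e s * b s t)" for e x t
    unfolding z_def using sum.reindex_bij_betw[OF alive_bij, of "\<lambda>s. e s * b s t"] by simp
  have P1: "\<forall>I\<in>set bs. 0 \<le> fst I \<and> ereal (fst I) < snd I"
    using xs(1) Q(1,4) filt by (auto simp: bs_def filtration_def V_def)
  have P2: "z i x \<in> cycles n (sublevel n f x) q" if "i \<in> alive x" for i x
  proof -
    have "xs ! i \<in> A x" using alive_bij that by (auto simp: bij_betw_def)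
    then show ?thesis
      unfolding cycles_def z_def using A_cycle b_chain A_W by blast
  qed
  have P3: "a i = 0"
    if 0: "(\<lambda>s. \<Sum>i\<in>alive x. a i * z i x s) \<in> boundaries n (sublevel n f x) q" and i: "i \<in> alive x"
    for a i x
  proof -
    define e where "e = (\<lambda>s. a (the_inv_into (alive x) ((!) xs) s))"
    have e: "e (xs ! j) = a j" if "j \<in> alive x" for j
      using alive_bij[of x] that by (simp add: e_def bij_betw_def the_inv_into_f_f)
    from 0 obtain c where c: "c \<in> chains (sublevel n f x) (Suc q)"
        "(\<lambda>s. \<Sum>i\<in>alive x. a i * z i x s) = boundary_map n c"
      unfolding boundaries_def by (elim imageE)
    from expand[OF c(1)] obtain e' where e': "\<forall>s. e' s \<noteq> 0 \<longrightarrow> s \<in> W x (Suc q)"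
        "c = (\<lambda>t. \<Sum>s\<in>V. e' s * b s t)"
      by (elim exE conjE)
    \<comment> \<open>Comparing coefficients with the boundary of the expanded chain
      \<open>c\<close>: the coefficient of a living class can come only from its killer, which is
      still absent at scale \<open>x\<close>.\<close>
    have "(\<Sum>s\<in>V. ((if s \<in> A x then e s else 0) - (if s \<in> F then e' (p s) else 0)) * b s t) = 0" for t
    proof -
      have "(\<Sum>s\<in>V. (if s \<in> A x then e s else 0) * b s t) = (\<Sum>i\<in>alive x. e (xs ! i) * z i x t)"
        unfolding reindex extend ..
      also have "\<dots> = (\<Sum>i\<in>alive x. a i * z i x t)"
        using e by (intro sum.cong) auto
      also have "\<dots> = boundary_map n c t"
        by (rule fun_cong[OF c(2)])
      also have "\<dots> = (\<Sum>s\<in>F. e' (p s) * b s t)"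
        unfolding e'(2) V_def boundary.normal_form_D[OF nf] ..
      also have "\<dots> = (\<Sum>s\<in>V. (if s \<in> F then e' (p s) else 0) * b s t)"
        unfolding V_def by (rule boundary.normal_form_sum_extend[OF nf])
      finally show ?thesis
        by (simp add: left_diff_distrib sum_subtractf)
    qed
    note coeff = boundary.adapted_independent[OF ad this]
    have sA: "xs ! i \<in> A x" using alive_bij i by (auto simp: bij_betw_def)
    then have "xs ! i \<in> V" using Q(1) by (auto simp: A_def)
    from coeff[OF this] have "a i = (if xs ! i \<in> F then e' (p (xs ! i)) else 0)"
      using sA e[OF i] by simp
    moreover have "e' (p (xs ! i)) = 0" if "xs ! i \<in> F"
    proof -
      have "p (xs ! i) \<notin> W x (Suc q)"
        using sA that by (simp add: A_def dth_def death_def W_def)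
      then show ?thesis using e'(1) by blast
    qed
    ultimately show "a i = 0" by simp
  qed
  have P4: "\<exists>a. (\<lambda>s. c s - (\<Sum>i\<in>alive x. a i * z i x s)) \<in> boundaries n (sublevel n f x) q"
    if c: "c \<in> cycles n (sublevel n f x) q" for c x
  proof -
    have c': "c \<in> chains (sublevel n f x) q" "boundary_map n c = (\<lambda>_. 0)"
      using c by (simp_all add: cycles_def)
    from expand[OF c'(1)] obtain e where e: "\<forall>s. e s \<noteq> 0 \<longrightarrow> s \<in> W x q"
        "c = (\<lambda>t. \<Sum>s\<in>V. e s * b s t)"
      by (elim exE conjE)
    have e_p: "e (p s) = 0" if "s \<in> F" for s
      using boundary.normal_form_cycle[OF nf _ that, of e] c'(2) by (simp add: e(2) V_def)
    \<comment> \<open>A cycle involves no killers, so \<open>s\<close> is positive. If it is not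
      alive its death lies below \<open>x\<close>; this includes the dropped empty bars, whose death
      is at most \<open>f s < x\<close>.\<close>
    have "b s \<in> boundaries n (sublevel n f x) q" if s: "s \<in> V - A x" "e s \<noteq> 0" for s
    proof -
      have sW: "s \<in> V" "f s < x" "card s = Suc q"
        using e(1) s(2) by (auto simp: W_def)
      have "s \<notin> p ` F" using e_p s(2) by auto
      then have "\<not> (ereal (f s) < dth s \<and> ereal x \<le> dth s)"
        using s(1) sW by (auto simp: A_def Q_def positive_simplices_def V_def)
      then have "dth s < ereal x"
        using sW(2) by (auto simp: not_less not_le intro: le_less_trans)
      then have "s \<in> F" "f (p s) < x"
        by (auto simp: dth_def death_def split: if_splits)
      then show ?thesis using dead sW(3) by blast
    qed
    then have "(\<lambda>t. \<Sum>s\<in>{s \<in> V - A x. e s \<noteq> 0}. e s * b s t) \<in> boundaries n (sublevel n f x) q"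
      by (intro lin_closed_sum lin) auto
    moreover have "c t - (\<Sum>i\<in>alive x. e (xs ! i) * z i x t) =
        (\<Sum>s\<in>{s \<in> V - A x. e s \<noteq> 0}. e s * b s t)" for t
    proof -
      have "c t = (\<Sum>s\<in>V - A x. e s * b s t) + (\<Sum>s\<in>A x. e s * b s t)"
        unfolding e(2) using A_W W_V finV by (intro sum.subset_diff) blast+
      moreover have "(\<Sum>s\<in>V - A x. e s * b s t) = (\<Sum>s\<in>{s \<in> V - A x. e s \<noteq> 0}. e s * b s t)"
        using finV by (intro sum.mono_neutral_right) auto
      ultimately show ?thesis unfolding reindex by simp
    qed
    ultimately show ?thesis
      by (intro exI[of _ "\<lambda>i. e (xs ! i)"]) simp
  qed
  have P5: "if y \<in> bar_interval (bs ! i)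
      then (\<lambda>s. z i y s - z i x s) \<in> boundaries n (sublevel n f y) q
      else z i x \<in> boundaries n (sublevel n f y) q"
    if i: "i < length bs" "x \<in> bar_interval (bs ! i)" and "x \<le> y" for i x y
  proof (cases "y \<in> bar_interval (bs ! i)")
    case True
    have "(\<lambda>_. 0) \<in> (boundaries n (sublevel n f y) q :: (nat set \<Rightarrow> 'f) set)"
      using lin by (simp add: lin_closed_def)
    then show ?thesis using True by (simp add: z_def)
  next
    case False
    have "xs ! i \<in> A x" using alive_bij i by (auto simp: bij_betw_def alive_def)
    then have "f (xs ! i) < y" "card (xs ! i) = Suc q"
      using \<open>x \<le> y\<close> Q(2) by (auto simp: A_def)
    moreover from this have "dth (xs ! i) < ereal y"
      using False i(1) by (auto simp: bar_interval_def bs_def not_le)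
    then have "xs ! i \<in> F" "f (p (xs ! i)) < y"
      by (auto simp: dth_def death_def split: if_splits)
    ultimately show ?thesis using False dead by (simp add: z_def)
  qed
  have "interval_decomposition (\<lambda>x. cycles n (sublevel n f x) q)
      (\<lambda>x. boundaries n (sublevel n f x) q :: (nat set \<Rightarrow> 'f) set) bs z"
  proof -
    have alive_eq: "{i. i < length bs \<and> x \<in> bar_interval (bs ! i)} = alive x" for x
      by (simp add: alive_def)
    show ?thesis
      unfolding interval_decomposition_def Let_def alive_eq
    proof (intro conjI allI impI)
      show "\<forall>I\<in>set bs. 0 \<le> fst I \<and> ereal (fst I) < snd I" by (rule P1)
    next
      fix x :: real
      show "\<forall>i\<in>alive x. z i x \<in> cycles n (sublevel n f x) q" by (intro ballI P2)
    next
      fix x :: real and a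
      assume "(\<lambda>s. \<Sum>i\<in>alive x. a i * z i x s) \<in> boundaries n (sublevel n f x) q"
      then show "\<forall>i\<in>alive x. a i = 0" by (intro ballI P3)
    next
      fix x :: real
      show "\<forall>c\<in>cycles n (sublevel n f x) q.
          \<exists>a. (\<lambda>s. c s - (\<Sum>i\<in>alive x. a i * z i x s)) \<in> boundaries n (sublevel n f x) q"
        by (intro ballI P4)
    next
      fix i
      assume "i < length bs"
      then show "\<forall>x\<in>bar_interval (bs ! i). \<forall>y\<ge>x. if y \<in> bar_interval (bs ! i)
          then (\<lambda>s. z i y s - z i x s) \<in> boundaries n (sublevel n f y) q
          else z i x \<in> boundaries n (sublevel n f y) q"
        by (intro ballI allI impI P5)
    qed
  qed
  moreover have "paired_barcode q n F p f = mset bs"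
  proof -
    have "filter_mset (\<lambda>s. ereal (f s) < death F p f s) (mset_set (positive_simplices q n F p)) =
        mset_set Q"
      unfolding Q_def dth_def
      by (rule filter_mset_mset_set) (simp add: positive_simplices_def finite_simplices)
    also have "\<dots> = mset xs"
      using xs mset_set_set by blast
    finally show ?thesis
      by (simp add: paired_barcode_def bs_def dth_def)
  qed
  ultimately show ?thesis by (intro exI conjI)
qed

section \<open>Stability\<close>

text \<open>Stated for arbitrary filtrations, because the interpolated ones need not come from a
  tuple of points.\<close>

definition filtration_barcode ::
  "'f::field itself \<Rightarrow> nat \<Rightarrow> nat \<Rightarrow> (nat set \<Rightarrow> real) \<Rightarrow> bar multiset" where
  "filtration_barcode F q n f = (THE C. \<exists>bs (z :: nat \<Rightarrow> real \<Rightarrow> nat set \<Rightarrow> 'f). C = mset bs \<and>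
     interval_decomposition (\<lambda>x. cycles n (sublevel n f x) q)
                            (\<lambda>x. boundaries n (sublevel n f x) q) bs z)"

lemma filtration_barcode_eqI:
  fixes z :: "nat \<Rightarrow> real \<Rightarrow> nat set \<Rightarrow> 'f::field"
  assumes "interval_decomposition (\<lambda>x. cycles n (sublevel n f x) q)
     (\<lambda>x. boundaries n (sublevel n f x) q) bs z"
  shows "filtration_barcode TYPE('f) q n f = mset bs"
  unfolding filtration_barcode_def
proof (rule the_equality)
  show "\<exists>bs' (z :: nat \<Rightarrow> real \<Rightarrow> nat set \<Rightarrow> 'f). mset bs = mset bs' \<and>
      interval_decomposition (\<lambda>x. cycles n (sublevel n f x) q)
        (\<lambda>x. boundaries n (sublevel n f x) q) bs' z"
    using assms by (intro exI conjI) (rule refl)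
next
  fix C
  assume "\<exists>bs (z :: nat \<Rightarrow> real \<Rightarrow> nat set \<Rightarrow> 'f). C = mset bs \<and>
      interval_decomposition (\<lambda>x. cycles n (sublevel n f x) q)
        (\<lambda>x. boundaries n (sublevel n f x) q) bs z"
  then obtain bs' and z' :: "nat \<Rightarrow> real \<Rightarrow> nat set \<Rightarrow> 'f" where C: "C = mset bs'" and
    dec': "interval_decomposition (\<lambda>x. cycles n (sublevel n f x) q)
        (\<lambda>x. boundaries n (sublevel n f x) q) bs' z'"
    by (elim exE conjE)
  have mono: "boundaries n (sublevel n f x) q \<subseteq> (boundaries n (sublevel n f y) q :: (nat set \<Rightarrow> 'f) set)"
    if "x \<le> y" for x y
    by (rule boundaries_mono) (use that in \<open>auto simp: sublevel_def\<close>)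
  show "C = mset bs"
    unfolding C by (rule interval_decomposition_unique[OF lin_closed_boundaries mono dec' assms])
qed

lemma filtration_barcode_paired:
  fixes b :: "nat set \<Rightarrow> nat set \<Rightarrow> 'f::field"
  assumes "boundary.normal_form n r (simplices n) b F p"
    and "\<And>s t. s \<in> simplices n \<Longrightarrow> t \<in> simplices n \<Longrightarrow> r t \<le> r s \<Longrightarrow> f t \<le> f s"
    and "filtration n f"
  shows "filtration_barcode TYPE('f) q n f = paired_barcode q n F p f"
proof -
  have "\<exists>bs z. paired_barcode q n F p f = mset bs \<and>
    interval_decomposition (\<lambda>x. cycles n (sublevel n f x) q)
      (\<lambda>x. boundaries n (sublevel n f x) q :: (nat set \<Rightarrow> 'f) set) bs z"
    using assms by (rule interval_decomposition_paired)
  then obtain bs and z :: "nat \<Rightarrow> real \<Rightarrow> nat set \<Rightarrow> 'f" where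
    eq: "paired_barcode q n F p f = mset bs" and
    dec: "interval_decomposition (\<lambda>x. cycles n (sublevel n f x) q)
      (\<lambda>x. boundaries n (sublevel n f x) q) bs z"
    by (elim exE conjE)
  show ?thesis
    unfolding eq by (rule filtration_barcode_eqI[OF dec])
qed

text \<open>Topological sorting: a maximal element receives a rank above all the others.\<close>

lemma linear_extension:
  assumes "finite V"
    and "\<And>x. x \<in> V \<Longrightarrow> \<not> lt x x"
    and "\<And>x y z. x \<in> V \<Longrightarrow> y \<in> V \<Longrightarrow> z \<in> V \<Longrightarrow> lt x y \<Longrightarrow> lt y z \<Longrightarrow> lt x z"
  shows "\<exists>r :: 'a \<Rightarrow> nat. inj_on r V \<and> (\<forall>x\<in>V. \<forall>y\<in>V. lt x y \<longrightarrow> r x < r y)"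
  using assms
proof (induction V rule: finite_psubset_induct)
  case (psubset V)
  show ?case
  proof (cases "V = {}")
    case False
    have asym: "asymp_on V lt"
    proof (rule asymp_onI)
      show "\<not> lt y x" if "x \<in> V" "y \<in> V" "lt x y" for x y
        using psubset.prems(2)[of x y x] psubset.prems(1)[of x] that by blast
    qed
    have trans: "transp_on V lt"
      by (rule transp_onI) (rule psubset.prems(2))
    from Finite_Set.bex_max_element[OF psubset.hyps(1) asym trans False]
    obtain m where m: "m \<in> V" "\<forall>x\<in>V. x \<noteq> m \<longrightarrow> \<not> lt m x"
      by blast
    have "\<exists>r :: 'a \<Rightarrow> nat. inj_on r (V - {m}) \<and>
        (\<forall>x\<in>V - {m}. \<forall>y\<in>V - {m}. lt x y \<longrightarrow> r x < r y)"
    proof (rule psubset.IH)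
      show "V - {m} \<subset> V" using m(1) by blast
      show "\<not> lt x x" if "x \<in> V - {m}" for x
        using psubset.prems(1) that by blast
      show "lt x z" if "x \<in> V - {m}" "y \<in> V - {m}" "z \<in> V - {m}" "lt x y" "lt y z" for x y z
        using psubset.prems(2)[of x y z] that by blast
    qed
    then obtain r :: "'a \<Rightarrow> nat" where r: "inj_on r (V - {m})"
        "\<And>x y. x \<in> V - {m} \<Longrightarrow> y \<in> V - {m} \<Longrightarrow> lt x y \<Longrightarrow> r x < r y"
      by blast
    define r' where "r' = r(m := Suc (Max (r ` V)))"
    have less: "r' x < r' m" if "x \<in> V - {m}" for x
      using that psubset.hyps(1) by (simp add: r'_def less_Suc_eq_le)
    have r'_r: "r' x = r x" if "x \<in> V - {m}" for x
      using that by (simp add: r'_def)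
    have "inj_on r' V"
    proof (rule inj_onI)
      fix x y assume xy: "x \<in> V" "y \<in> V" "r' x = r' y"
      consider "x = y" | "x = m" "y \<in> V - {m}" | "y = m" "x \<in> V - {m}" |
          "x \<in> V - {m}" "y \<in> V - {m}"
        using xy by blast
      then show "x = y"
      proof cases
        case 2
        then show ?thesis using less[OF 2(2)] xy(3) by simp
      next
        case 3
        then show ?thesis using less[OF 3(2)] xy(3) by simp
      next
        case 4
        then show ?thesis using inj_onD[OF r(1)] r'_r[OF 4(1)] r'_r[OF 4(2)] xy(3) by simp
      qed
    qed
    moreover have "r' x < r' y" if xy: "x \<in> V" "y \<in> V" "lt x y" for x y
    proof -
      have "x \<noteq> m"
        using m(2) xy psubset.prems(1)[OF m(1)] by metis
      then have "x \<in> V - {m}"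
        using xy(1) by blast
      then show ?thesis
        using less[of x] r(2)[of x y] r'_r[of x] r'_r[of y] xy by (cases "y = m") simp_all
    qed
    ultimately show ?thesis by (intro exI[of _ r']) blast
  qed simp
qed

text \<open>If \<open>g\<close> refines the preorder of \<open>f\<close>, sorting the simplices by \<open>g\<close> serves both filtrations.\<close>

lemma common_normal_form:
  fixes f g :: "nat set \<Rightarrow> real"
  assumes "filtration n g"
    and refine: "\<And>s t. s \<in> simplices n \<Longrightarrow> t \<in> simplices n \<Longrightarrow> f s < f t \<Longrightarrow> g s < g t"
  shows "\<exists>r (b :: nat set \<Rightarrow> nat set \<Rightarrow> 'f::field) F p.
    boundary.normal_form n r (simplices n) b F p \<and>
    (\<forall>s\<in>simplices n. \<forall>t\<in>simplices n. r t \<le> r s \<longrightarrow> f t \<le> f s \<and> g t \<le> g s)"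
proof -
  \<comment> \<open>Breaking ties by cardinality puts every face before its simplex, as the normal
    form requires even when both enter at the same scale.\<close>
  define lt where "lt = (\<lambda>s t. g s < g t \<or> g s = g t \<and> card s < card t)"
  have "\<exists>r :: nat set \<Rightarrow> nat. inj_on r (simplices n) \<and>
      (\<forall>s\<in>simplices n. \<forall>t\<in>simplices n. lt s t \<longrightarrow> r s < r t)"
    by (rule linear_extension[OF finite_simplices]) (auto simp: lt_def)
  then obtain r :: "nat set \<Rightarrow> nat" where r: "inj_on r (simplices n)"
      "\<And>s t. s \<in> simplices n \<Longrightarrow> t \<in> simplices n \<Longrightarrow> lt s t \<Longrightarrow> r s < r t"
    by blast
  have compat: "f t \<le> f s \<and> g t \<le> g s"
    if "s \<in> simplices n" "t \<in> simplices n" "r t \<le> r s" for s t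
  proof -
    have "\<not> lt s t"
      using r(2)[OF that(1,2)] that(3) by auto
    then have "g t \<le> g s" by (auto simp: lt_def)
    then show ?thesis
      using refine[OF that(1,2)] by (meson not_less)
  qed
  have "t \<in> simplices n \<and> card s = Suc (card t) \<and> r t < r s"
    if st: "s \<in> simplices n" "boundary_map n (unit_chain s) t \<noteq> (0::'f)" for s t
  proof -
    obtain v where v: "t \<noteq> {}" "v \<notin> t" "s = insert v t"
      using boundary_unit_chain[OF st(2)] by blast
    have fin: "finite t"
      using st(1) finite_subset[of s "{..<n}"] by (simp add: simplices_def v(3))
    have t: "t \<in> simplices n"
      using st(1) v by (auto simp: simplices_def)
    have card: "card s = Suc (card t)"
      using fin v(2,3) by simp
    have "g t \<le> g s"
      using assms(1) st(1) t v(3) by (auto simp: filtration_def)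
    then have "lt t s"
      using card by (auto simp: lt_def)
    with t card show ?thesis
      using r(2)[OF t st(1)] by blast
  qed
  then have "boundary.closed_cells TYPE('f) n r (simplices n)"
    unfolding boundary.closed_cells_def using r(1) finite_simplices by blast
  then have "\<exists>(b :: nat set \<Rightarrow> nat set \<Rightarrow> 'f) F p. boundary.normal_form n r (simplices n) b F p"
    by (rule boundary.normal_form_exists)
  then show ?thesis
    using compat by blast
qed

text \<open>Discarded items reappear as diagonal points, so that barcodes indexed by the same
  multiset can be compared index by index.\<close>

lemma padded_filter:
  "\<exists>k. padded k (image_mset h (filter_mset P Q)) =
     image_mset (\<lambda>s. if P s then Some (h s) else None) Q"
proof (induction Q)
  case (add s Q)
  then obtain k where k: "padded k (image_mset h (filter_mset P Q)) =
     image_mset (\<lambda>s. if P s then Some (h s) else None) Q" by blast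
  show ?case
    by (rule exI[of _ "if P s then k else Suc k"]) (use k in \<open>auto simp: padded_def\<close>)
qed (simp add: padded_def exI[of _ 0])

text \<open>Bars are matched by their birth simplices, which index both barcodes. Birth and death
  move by at most \<epsilon> each, so a bar that is empty for one filtration has length at most 2
  \<epsilon> for the other.\<close>

lemma paired_barcode_near:
  assumes near: "\<And>s. s \<in> simplices n \<Longrightarrow> \<bar>f s - g s\<bar> \<le> \<epsilon>"
    and F: "\<And>s. s \<in> F \<Longrightarrow> p s \<in> simplices n"
  shows "near_barcodes \<epsilon> (paired_barcode q n F p f) (paired_barcode q n F p g)"
proof -
  define Q where "Q = positive_simplices q n F p"
  define opt where "opt = (\<lambda>f s. if ereal (f s) < death F p f s
      then Some (f s, death F p f s) else None)"
  obtain k where k: "padded k (paired_barcode q n F p f) = image_mset (opt f) (mset_set Q)"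
    unfolding paired_barcode_def opt_def Q_def using padded_filter by blast
  obtain l where l: "padded l (paired_barcode q n F p g) = image_mset (opt g) (mset_set Q)"
    unfolding paired_barcode_def opt_def Q_def using padded_filter by blast
  have rel: "bars_related \<epsilon> (opt f s) (opt g s)" if "s \<in># mset_set Q" for s
  proof -
    have "s \<in> simplices n"
      using that by (simp add: Q_def positive_simplices_def finite_simplices)
    note s = near[OF this]
    show ?thesis
    proof (cases "s \<in> F")
      case True
      then show ?thesis
        using s near[OF F[OF True]]
        by (auto simp: opt_def death_def bars_close_def bar_short_def abs_le_iff)
    next
      case False
      then show ?thesis
        using s by (simp add: opt_def death_def bars_close_def)
    qed
  qed
  have "rel_mset (bars_related \<epsilon>) (image_mset (opt f) (mset_set Q)) (image_mset (opt g) (mset_set Q))"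
    unfolding multiset.rel_map by (rule multiset.rel_refl_strong) (rule rel)
  then show ?thesis
    unfolding near_barcodes_def k[symmetric] l[symmetric] by blast
qed

lemma filtration_barcode_near_refinement:
  assumes "filtration n f" "filtration n g"
    and "\<And>s t. s \<in> simplices n \<Longrightarrow> t \<in> simplices n \<Longrightarrow> f s < f t \<Longrightarrow> g s < g t"
    and "\<And>s. s \<in> simplices n \<Longrightarrow> \<bar>f s - g s\<bar> \<le> \<epsilon>"
  shows "near_barcodes \<epsilon> (filtration_barcode TYPE('f::field) q n f)
    (filtration_barcode TYPE('f) q n g)"
proof -
  have "\<exists>r (b :: nat set \<Rightarrow> nat set \<Rightarrow> 'f) F p.
    boundary.normal_form n r (simplices n) b F p \<and>
    (\<forall>s\<in>simplices n. \<forall>t\<in>simplices n. r t \<le> r s \<longrightarrow> f t \<le> f s \<and> g t \<le> g s)"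
    by (rule common_normal_form[OF assms(2,3)])
  then obtain r and b :: "nat set \<Rightarrow> nat set \<Rightarrow> 'f" and F p where
    nf: "boundary.normal_form n r (simplices n) b F p" and
    compat: "\<forall>s\<in>simplices n. \<forall>t\<in>simplices n. r t \<le> r s \<longrightarrow> f t \<le> f s \<and> g t \<le> g s"
    by (elim exE conjE)
  have "filtration_barcode TYPE('f) q n f = paired_barcode q n F p f"
    by (rule filtration_barcode_paired[OF nf _ assms(1)]) (use compat in blast)
  moreover have "filtration_barcode TYPE('f) q n g = paired_barcode q n F p g"
    by (rule filtration_barcode_paired[OF nf _ assms(2)]) (use compat in blast)
  ultimately show ?thesis
    using paired_barcode_near[OF assms(4) boundary.normal_formD(5)[OF nf]] by simp
qed

text \<open>Every filtration refines itself, so the common normal form also serves a single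
  one.\<close>

lemma filtration_barcode_in_barcodes:
  assumes "filtration n f"
  shows "filtration_barcode TYPE('f::field) q n f \<in> barcodes"
proof -
  have "\<exists>r (b :: nat set \<Rightarrow> nat set \<Rightarrow> 'f) F p.
    boundary.normal_form n r (simplices n) b F p \<and>
    (\<forall>s\<in>simplices n. \<forall>t\<in>simplices n. r t \<le> r s \<longrightarrow> f t \<le> f s \<and> f t \<le> f s)"
    by (rule common_normal_form[OF assms])
  then obtain r and b :: "nat set \<Rightarrow> nat set \<Rightarrow> 'f" and F p where
    nf: "boundary.normal_form n r (simplices n) b F p" and
    compat: "\<forall>s\<in>simplices n. \<forall>t\<in>simplices n. r t \<le> r s \<longrightarrow> f t \<le> f s \<and> f t \<le> f s"
    by (elim exE conjE)
  have "filtration_barcode TYPE('f) q n f = paired_barcode q n F p f"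
    by (rule filtration_barcode_paired[OF nf _ assms(1)]) (use compat in blast)
  moreover have "paired_barcode q n F p f \<in> barcodes"
    unfolding barcodes_def paired_barcode_def by auto
  ultimately show ?thesis by simp
qed

theorem filtration_barcode_stable:
  assumes f: "filtration n f" and g: "filtration n g"
    and near: "\<And>s. s \<in> simplices n \<Longrightarrow> \<bar>f s - g s\<bar> \<le> \<epsilon>" and "0 \<le> \<epsilon>"
  shows "near_barcodes \<epsilon> (filtration_barcode TYPE('f::field) q n f)
    (filtration_barcode TYPE('f) q n g)"
proof -
  define h where "h = (\<lambda>(t::real) s. (1 - t) * f s + t * g s)"
  define B where "B = (\<lambda>t. filtration_barcode TYPE('f) q n (h t))"
  have h_filt: "filtration n (h t)" if "0 \<le> t" "t \<le> 1" for t
    using f g that unfolding filtration_def h_def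
    by (auto intro!: add_nonneg_nonneg mult_nonneg_nonneg add_mono mult_left_mono)
  have h_diff: "\<bar>h x s - h y s\<bar> \<le> \<epsilon> * \<bar>x - y\<bar>" if "s \<in> simplices n" for x y s
  proof -
    have "h x s - h y s = (y - x) * (f s - g s)"
      by (simp add: h_def algebra_simps)
    then have "\<bar>h x s - h y s\<bar> = \<bar>x - y\<bar> * \<bar>f s - g s\<bar>"
      by (simp add: abs_mult abs_minus_commute)
    also have "\<dots> \<le> \<bar>x - y\<bar> * \<epsilon>"
      using near[OF that] by (intro mult_left_mono) auto
    finally show ?thesis by (simp add: mult.commute)
  qed
  \<comment> \<open>The factor \<open>b - a\<close> makes local estimates add up over a subdivision.
    The guard is there because \<open>h t\<close> is known to be a filtration only for
    \<open>t\<close> between 0 and 1, while the local intervals may stick out.\<close>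
  define P where "P = (\<lambda>a b. 0 \<le> a \<and> b \<le> 1 \<longrightarrow> near_barcodes (\<epsilon> * (b - a)) (B a) (B b))"
  have "P 0 1"
    using zero_le_one
  proof (induction rule: Bolzano)
    case (trans a b c)
    show ?case
      unfolding P_def
    proof
      assume "0 \<le> a \<and> c \<le> 1"
      then have "near_barcodes (\<epsilon> * (b - a)) (B a) (B b)" "near_barcodes (\<epsilon> * (c - b)) (B b) (B c)"
        using trans by (auto simp: P_def)
      then have "near_barcodes (\<epsilon> * (b - a) + \<epsilon> * (c - b)) (B a) (B c)"
        using trans(3,4) \<open>0 \<le> \<epsilon>\<close> by (intro near_barcodes_trans) auto
      then show "near_barcodes (\<epsilon> * (c - a)) (B a) (B c)"
        by (simp add: algebra_simps)
    qed
  next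
    \<comment> \<open>The finitely many strict inequalities at \<open>x\<close> persist nearby,
      while ties may break. So \<open>h y\<close> refines the preorder of \<open>h x\<close>, but
      two nearby parameters on different sides of \<open>x\<close> may disagree.\<close>
    case (local x)
    have "\<forall>\<^sub>F y in nhds x. h x (fst u) < h x (snd u) \<longrightarrow> h y (fst u) < h y (snd u)"
      for u :: "nat set \<times> nat set"
    proof (cases "h x (fst u) < h x (snd u)")
      case True
      have "open {y. h y (fst u) < h y (snd u)}"
        unfolding h_def by (intro open_Collect_less continuous_intros)
      then have "\<forall>\<^sub>F y in nhds x. y \<in> {y. h y (fst u) < h y (snd u)}"
        using True by (intro eventually_nhds_in_open) auto
      then show ?thesis by eventually_elim simp
    qed simp
    then have "\<forall>\<^sub>F y in nhds x. \<forall>u\<in>simplices n \<times> simplices n.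
        h x (fst u) < h x (snd u) \<longrightarrow> h y (fst u) < h y (snd u)"
      by (intro eventually_ball_finite) (simp_all add: finite_simplices)
    then obtain d where "d > 0" and d: "\<And>y s t. dist y x < d \<Longrightarrow> s \<in> simplices n \<Longrightarrow>
        t \<in> simplices n \<Longrightarrow> h x s < h x t \<Longrightarrow> h y s < h y t"
      unfolding eventually_nhds_metric by force
    have near_x: "near_barcodes (\<epsilon> * \<bar>x - y\<bar>) (B x) (B y)" if "0 \<le> y" "y \<le> 1" "dist y x < d" for y
      unfolding B_def
    proof (rule filtration_barcode_near_refinement)
      show "filtration n (h x)" "filtration n (h y)"
        using h_filt that local by auto
    qed (use d[OF that(3)] h_diff in auto)
    \<comment> \<open>Only comparisons with \<open>x\<close> itself are available, so the interval
      is cut at \<open>x\<close>.\<close>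
    have "P a b" if "a \<le> x" "x \<le> b" "b - a < d" for a b
      unfolding P_def
    proof
      assume ab: "0 \<le> a \<and> b \<le> 1"
      have "near_barcodes (\<epsilon> * (x - a)) (B a) (B x)"
        using near_barcodes_sym[OF near_x[of a]] that ab local by (simp add: dist_real_def)
      moreover have "near_barcodes (\<epsilon> * (b - x)) (B x) (B b)"
        using near_x[of b] that ab local by (simp add: dist_real_def)
      ultimately have "near_barcodes (\<epsilon> * (x - a) + \<epsilon> * (b - x)) (B a) (B b)"
        using that \<open>0 \<le> \<epsilon>\<close> by (intro near_barcodes_trans[where C = "B x"]) auto
      then show "near_barcodes (\<epsilon> * (b - a)) (B a) (B b)"
        by (simp add: algebra_simps)
    qed
    with \<open>d > 0\<close> show ?case by blast
  qed
  moreover have "h 0 = f" "h 1 = g"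
    by (simp_all add: h_def)
  ultimately show ?thesis
    by (simp add: P_def B_def)
qed

section \<open>Vietoris-Rips filtrations of tuples\<close>

definition diameter_filtration ::
  "('m \<Rightarrow> 'm \<Rightarrow> real) \<Rightarrow> (nat \<Rightarrow> 'm) \<Rightarrow> nat set \<Rightarrow> real" where
  "diameter_filtration d y s = Max ((\<lambda>(i, j). d (y i) (y j)) ` (s \<times> s))"

lemma finite_simplex: "s \<in> simplices n \<Longrightarrow> finite (s \<times> s) \<and> s \<times> s \<noteq> {}"
  by (auto simp: simplices_def intro: finite_subset)

lemma diameter_filtration_le_iff:
  assumes "s \<in> simplices n"
  shows "diameter_filtration d y s \<le> x \<longleftrightarrow> (\<forall>i\<in>s. \<forall>j\<in>s. d (y i) (y j) \<le> x)"
  using finite_simplex[OF assms] unfolding diameter_filtration_def by (subst Max_le_iff) auto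

lemma diameter_filtration_less_iff:
  assumes "s \<in> simplices n"
  shows "diameter_filtration d y s < x \<longleftrightarrow> (\<forall>i\<in>s. \<forall>j\<in>s. d (y i) (y j) < x)"
  using finite_simplex[OF assms] unfolding diameter_filtration_def by (subst Max_less_iff) auto

lemma vietoris_rips_sublevel: "vietoris_rips n d y x = sublevel n (diameter_filtration d y) x"
  unfolding vietoris_rips_def sublevel_def
proof (rule Collect_cong)
  fix s
  show "(s \<subseteq> {..<n} \<and> s \<noteq> {} \<and> (\<forall>i\<in>s. \<forall>j\<in>s. d (y i) (y j) < x)) =
      (s \<in> simplices n \<and> diameter_filtration d y s < x)"
  proof (cases "s \<in> simplices n")
    case True
    then show ?thesis
      by (simp only: diameter_filtration_less_iff[OF True]) (simp add: simplices_def)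
  qed (auto simp: simplices_def)
qed

lemma PH_eq: "PH F q n d y = filtration_barcode F q n (diameter_filtration d y)"
  by (simp only: PH_def filtration_barcode_def vietoris_rips_sublevel)

lemma filtration_diameter: "filtration n (diameter_filtration dist y)"
  unfolding filtration_def
proof (intro conjI ballI impI)
  fix s assume s: "s \<in> simplices n"
  then obtain i where "i \<in> s" by (auto simp: simplices_def)
  then show "0 \<le> diameter_filtration dist y s"
    using iffD1[OF diameter_filtration_le_iff[OF s] order_refl, of dist y]
    by (meson order_trans zero_le_dist)
next
  fix s t assume st: "s \<in> simplices n" "t \<in> simplices n" "t \<subseteq> s"
  then show "diameter_filtration dist y t \<le> diameter_filtration dist y s"
    using iffD1[OF diameter_filtration_le_iff[OF st(1)] order_refl, of dist y]
    unfolding diameter_filtration_le_iff[OF st(2)] by blast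
qed

lemma diameter_filtration_perturb:
  assumes "\<And>i. i < n \<Longrightarrow> dist (y i) (y' i) \<le> \<delta>" and s: "s \<in> simplices n"
  shows "diameter_filtration dist y s \<le> diameter_filtration dist y' s + 2 * \<delta>"
  unfolding diameter_filtration_le_iff[OF s]
proof (intro ballI)
  fix i j assume ij: "i \<in> s" "j \<in> s"
  then have "i < n" "j < n" using s by (auto simp: simplices_def)
  have "dist (y i) (y j) \<le> dist (y i) (y' i) + dist (y' i) (y' j) + dist (y j) (y' j)"
    by metric
  also have "dist (y' i) (y' j) \<le> diameter_filtration dist y' s"
    using iffD1[OF diameter_filtration_le_iff[OF s] order_refl, of dist y'] ij by blast
  finally show "dist (y i) (y j) \<le> diameter_filtration dist y' s + 2 * \<delta>"
    using assms(1)[OF \<open>i < n\<close>] assms(1)[OF \<open>j < n\<close>] by simp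
qed

theorem PH_stable:
  assumes "\<And>i. i < n \<Longrightarrow> dist (y i) (y' i) \<le> \<delta>" "0 \<le> \<delta>"
  shows "near_barcodes (2 * \<delta>) (PH TYPE('f::field) q n dist y) (PH TYPE('f) q n dist y')"
  unfolding PH_eq
proof (rule filtration_barcode_stable[OF filtration_diameter filtration_diameter])
  fix s assume s: "s \<in> simplices n"
  show "\<bar>diameter_filtration dist y s - diameter_filtration dist y' s\<bar> \<le> 2 * \<delta>"
    using diameter_filtration_perturb[of n y y' \<delta> s]
      diameter_filtration_perturb[of n y' y \<delta> s] assms(1) s
    by (auto simp: abs_le_iff dist_commute)
qed (use assms in simp)

lemma PH_in_barcodes: "PH TYPE('f::field) q n dist y \<in> barcodes"
  unfolding PH_eq by (rule filtration_barcode_in_barcodes[OF filtration_diameter])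

text \<open>Allows replacing \<open>compose {..<n} X\<close>, which is undefined outside the index
  set, by pointwise application of \<open>X\<close>.\<close>

lemma PH_cong:
  assumes "\<And>i. i < n \<Longrightarrow> y i = y' i"
  shows "PH F q n d y = PH F q n d y'"
proof -
  have "vietoris_rips n d y x = vietoris_rips n d y' x" for x
    unfolding vietoris_rips_def using assms by (auto simp: subset_iff)
  then show ?thesis by (simp add: PH_def)
qed

section \<open>Laws of random barcodes\<close>

lemma barcode_opens_subset:
  "{U. U \<subseteq> barcodes \<and>
     (\<forall>B\<in>U. \<exists>\<epsilon>>0. \<forall>C\<in>barcodes. bottleneck B C < ennreal \<epsilon> \<longrightarrow> C \<in> U)} \<subseteq> Pow barcodes"
  by blast

lemma space_barcode_borel: "space barcode_borel = barcodes"
  unfolding barcode_borel_def by (rule space_measure_of[OF barcode_opens_subset])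

lemma open_in_barcode_borel:
  assumes "U \<subseteq> barcodes"
    and "\<And>B. B \<in> U \<Longrightarrow> \<exists>\<epsilon>>0. \<forall>C\<in>barcodes. bottleneck B C < ennreal \<epsilon> \<longrightarrow> C \<in> U"
  shows "U \<in> sets barcode_borel"
  unfolding barcode_borel_def sets_measure_of[OF barcode_opens_subset]
  by (rule sigma_sets.Basic) (use assms in blast)

text \<open>The neighbourhood of any set is open: a barcode reached with \<delta> < \<epsilon>
  leaves room \<epsilon> - \<delta> in the triangle inequality.\<close>

lemma barcode_neighbourhood_measurable:
  "{C \<in> barcodes. \<exists>B\<in>A. bottleneck B C < ennreal \<epsilon>} \<in> sets barcode_borel"
proof (rule open_in_barcode_borel)
  fix C assume "C \<in> {C \<in> barcodes. \<exists>B\<in>A. bottleneck B C < ennreal \<epsilon>}"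
  then obtain B \<delta> where B: "B \<in> A" "0 \<le> \<delta>" "\<delta> < \<epsilon>" "near_barcodes \<delta> B C"
    by (auto simp: bottleneck_less_iff)
  have "bottleneck B D < ennreal \<epsilon>" if D: "bottleneck C D < ennreal (\<epsilon> - \<delta>)" for D
  proof -
    obtain \<eta> where "0 \<le> \<eta>" "\<eta> < \<epsilon> - \<delta>" "near_barcodes \<eta> C D"
      using D by (auto simp: bottleneck_less_iff)
    moreover from this have "near_barcodes (\<delta> + \<eta>) B D"
      using B(2,4) by (intro near_barcodes_trans[where C = C])
    ultimately show ?thesis
      using B(2) by (auto simp: bottleneck_less_iff intro!: exI[of _ "\<delta> + \<eta>"])
  qed
  then show "\<exists>\<eta>>0. \<forall>D\<in>barcodes. bottleneck C D < ennreal \<eta> \<longrightarrow>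
      D \<in> {C \<in> barcodes. \<exists>B\<in>A. bottleneck B C < ennreal \<epsilon>}"
    using B(1,3) by (intro exI[of _ "\<epsilon> - \<delta>"]) auto
qed blast

lemma open_finite_cylinder:
  fixes y :: "nat \<Rightarrow> 'm::metric_space"
  shows "open {y'. \<forall>i<n. dist (y i) (y' i) < \<epsilon>}"
proof -
  have "open {y' :: nat \<Rightarrow> 'm. dist (y i) (y' i) < \<epsilon>}" for i
    by (intro open_Collect_less continuous_intros continuous_on_product_coordinates)
  then have "open (\<Inter>i\<in>{..<n}. {y' :: nat \<Rightarrow> 'm. dist (y i) (y' i) < \<epsilon>})"
    by (intro open_INT) auto
  moreover have "(\<Inter>i\<in>{..<n}. {y'. dist (y i) (y' i) < \<epsilon>}) =
      {y'. \<forall>i<n. dist (y i) (y' i) < \<epsilon>}"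
    by auto
  ultimately show ?thesis by simp
qed

text \<open>Stability makes \<open>PH\<close> continuous on the space of all sequences. The law
  lives on tuples indexed by \<open>{..<n}\<close>, so the open preimage is pulled back along the
  inclusion, whose remaining coordinates are constantly \<open>undefined\<close>.\<close>

lemma measurable_PH:
  fixes \<sigma> :: "'m::{metric_space, second_countable_topology} measure"
  assumes "sets \<sigma> = sets borel"
  shows "PH TYPE('f::field) q n dist \<in> PiM {..<n} (\<lambda>_. \<sigma>) \<rightarrow>\<^sub>M barcode_borel"
  unfolding barcode_borel_def
proof (rule measurable_measure_of[OF barcode_opens_subset])
  show "PH TYPE('f) q n dist \<in> space (PiM {..<n} (\<lambda>_. \<sigma>)) \<rightarrow> barcodes"
    using PH_in_barcodes by blast
next
  fix U :: "bar multiset set"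
  assume "U \<in> {U. U \<subseteq> barcodes \<and>
     (\<forall>B\<in>U. \<exists>\<epsilon>>0. \<forall>C\<in>barcodes. bottleneck B C < ennreal \<epsilon> \<longrightarrow> C \<in> U)}"
  then have U: "\<And>B. B \<in> U \<Longrightarrow> \<exists>\<epsilon>>0. \<forall>C\<in>barcodes. bottleneck B C < ennreal \<epsilon> \<longrightarrow> C \<in> U"
    by blast
  define O' where "O' = {y :: nat \<Rightarrow> 'm. PH TYPE('f) q n dist y \<in> U}"
  have "open O'"
  proof (subst open_subopen, intro ballI)
    fix y assume "y \<in> O'"
    then obtain \<epsilon> where \<epsilon>: "0 < \<epsilon>"
        "\<And>C. C \<in> barcodes \<Longrightarrow> bottleneck (PH TYPE('f) q n dist y) C < ennreal \<epsilon> \<Longrightarrow> C \<in> U"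
      using U unfolding O'_def by blast
    \<comment> \<open>Stability doubles the displacement, and 2 \<epsilon> / 3 stays strictly below
      \<epsilon>.\<close>
    have "{y'. \<forall>i<n. dist (y i) (y' i) < \<epsilon> / 3} \<subseteq> O'"
    proof
      fix y' assume "y' \<in> {y'. \<forall>i<n. dist (y i) (y' i) < \<epsilon> / 3}"
      then have "near_barcodes (2 * (\<epsilon> / 3)) (PH TYPE('f) q n dist y) (PH TYPE('f) q n dist y')"
        using \<epsilon>(1) by (intro PH_stable) (auto intro: less_imp_le)
      then have "bottleneck (PH TYPE('f) q n dist y) (PH TYPE('f) q n dist y') < ennreal \<epsilon>"
        using \<epsilon>(1) by (auto simp: bottleneck_less_iff intro!: exI[of _ "2 * (\<epsilon> / 3)"])
      then show "y' \<in> O'"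
        unfolding O'_def using \<epsilon>(2)[OF PH_in_barcodes] by blast
    qed
    moreover have "y \<in> {y'. \<forall>i<n. dist (y i) (y' i) < \<epsilon> / 3}"
      using \<epsilon>(1) by simp
    ultimately show "\<exists>T. open T \<and> y \<in> T \<and> T \<subseteq> O'"
      using open_finite_cylinder by blast
  qed
  \<comment> \<open>Second countability identifies the Borel sets of the countable product with the
    product sigma-algebra.\<close>
  then have "O' \<in> sets (PiM UNIV (\<lambda>_. borel))"
    by (simp add: sets_PiM_equal_borel)
  moreover have "(\<lambda>y i. y i) \<in> PiM {..<n} (\<lambda>_. \<sigma>) \<rightarrow>\<^sub>M PiM UNIV (\<lambda>_. borel :: 'm measure)"
  proof (rule measurable_abs_UNIV)
    fix i
    show "(\<lambda>y. y i) \<in> PiM {..<n} (\<lambda>_. \<sigma>) \<rightarrow>\<^sub>M (borel :: 'm measure)"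
    proof (cases "i < n")
      case True
      then have "(\<lambda>y. y i) \<in> PiM {..<n} (\<lambda>_. \<sigma>) \<rightarrow>\<^sub>M \<sigma>"
        by (intro measurable_component_singleton) simp
      then show ?thesis
        using assms measurable_cong_sets by blast
    next
      case False
      have "y i = undefined" if "y \<in> space (PiM {..<n} (\<lambda>_. \<sigma>))" for y
        using that False by (auto simp: space_PiM PiE_def extensional_def)
      then show ?thesis
        by (subst measurable_cong[where g = "\<lambda>_. undefined"]) simp_all
    qed
  qed
  ultimately have "(\<lambda>y i. y i) -` O' \<inter> space (PiM {..<n} (\<lambda>_. \<sigma>)) \<in> sets (PiM {..<n} (\<lambda>_. \<sigma>))"
    by (intro measurable_sets)
  then show "PH TYPE('f) q n dist -` U \<inter> space (PiM {..<n} (\<lambda>_. \<sigma>)) \<in> sets (PiM {..<n} (\<lambda>_. \<sigma>))"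
    by (simp add: O'_def vimage_def)
qed

lemma space_PH_law: "space (PH_law F q n d \<mu>) = barcodes"
  by (simp add: PH_law_def space_barcode_borel)

lemma sets_PH_law: "sets (PH_law F q n d \<mu>) = sets barcode_borel"
  by (simp add: PH_law_def)

text \<open>With a coupling for \<open>M\<close> and a projection for \<open>X\<close>, this
  realises both laws on the same product space, where the two samples can be compared point by
  point.\<close>

lemma PH_law_distr:
  fixes \<sigma> :: "'m::{metric_space, second_countable_topology} measure"
  assumes "prob_space M" and X: "X \<in> M \<rightarrow>\<^sub>M \<sigma>" and \<sigma>: "sets \<sigma> = sets borel"
  shows "PH_law TYPE('f::field) q n dist (distr M \<sigma> X) =
    distr (PiM {..<n} (\<lambda>_. M)) barcode_borel (\<lambda>\<omega>. PH TYPE('f) q n dist (\<lambda>i. X (\<omega> i)))"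
proof -
  define N where "N = distr M \<sigma> X"
  have N: "sets N = sets borel" "prob_space N" "X \<in> M \<rightarrow>\<^sub>M N"
    using prob_space.prob_space_distr[OF assms(1) X] X by (auto simp: N_def \<sigma>)
  have "distr M N X = N"
    unfolding N_def by (rule distr_cong) auto
  then have PiN: "PiM {..<n} (\<lambda>_. N) =
      distr (PiM {..<n} (\<lambda>_. M)) (PiM {..<n} (\<lambda>_. N)) (compose {..<n} X)"
    using distr_PiM_finite_prob_space'[of "{..<n}" "\<lambda>_. M" "\<lambda>_. N" X] assms(1) N by simp
  have comp: "compose {..<n} X \<in> PiM {..<n} (\<lambda>_. M) \<rightarrow>\<^sub>M PiM {..<n} (\<lambda>_. N)"
    unfolding compose_def using N(3) by measurable
  have "PH_law TYPE('f) q n dist N =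
      distr (PiM {..<n} (\<lambda>_. M)) barcode_borel (PH TYPE('f) q n dist \<circ> compose {..<n} X)"
    unfolding PH_law_def by (subst PiN) (rule distr_distr[OF measurable_PH[OF N(1)] comp])
  also have "\<dots> = distr (PiM {..<n} (\<lambda>_. M)) barcode_borel (\<lambda>\<omega>. PH TYPE('f) q n dist (\<lambda>i. X (\<omega> i)))"
    unfolding o_def by (intro distr_cong refl PH_cong) (simp add: compose_def)
  finally show ?thesis by (simp add: N_def)
qed

lemma measurable_PH_map:
  fixes X :: "'w \<Rightarrow> 'm::{metric_space, second_countable_topology}"
  assumes "X \<in> borel_measurable M"
  shows "(\<lambda>\<omega>. PH TYPE('f::field) q n dist (\<lambda>i. X (\<omega> i))) \<in>
    PiM {..<n} (\<lambda>_. M) \<rightarrow>\<^sub>M barcode_borel"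
proof -
  have "compose {..<n} X \<in> PiM {..<n} (\<lambda>_. M) \<rightarrow>\<^sub>M PiM {..<n} (\<lambda>_. borel)"
    unfolding compose_def using assms by measurable
  from measurable_compose[OF this measurable_PH[OF refl]]
  have "(\<lambda>\<omega>. PH TYPE('f) q n dist (compose {..<n} X \<omega>)) \<in>
      PiM {..<n} (\<lambda>_. M) \<rightarrow>\<^sub>M barcode_borel" .
  moreover have "PH TYPE('f) q n dist (compose {..<n} X \<omega>) =
      PH TYPE('f) q n dist (\<lambda>i. X (\<omega> i))" for \<omega>
    by (rule PH_cong) (simp add: compose_def)
  ultimately show ?thesis by simp
qed

text \<open>The inclusion of a set of full measure carries the restricted measure to \<nu>, so this
  is the preceding transfer of laws along the identity.\<close>

lemma PH_law_restrict_space: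
  fixes \<nu> :: "'m::{metric_space, second_countable_topology} measure"
  assumes "prob_space \<nu>" and \<nu>: "sets \<nu> = sets borel" and S: "S \<in> sets \<nu>" "emeasure \<nu> S = 1"
  shows "PH_law TYPE('f::field) q n dist (restrict_space \<nu> S) = PH_law TYPE('f) q n dist \<nu>"
proof -
  interpret prob_space \<nu> by fact
  define R where "R = restrict_space \<nu> S"
  have R: "prob_space R"
    unfolding R_def by (rule prob_space_restrict_space[OF S])
  have id: "(\<lambda>x. x) \<in> R \<rightarrow>\<^sub>M \<nu>"
    unfolding R_def by (rule measurable_restrict_space1) simp
  have "distr R \<nu> (\<lambda>x. x) = \<nu>"
  proof (rule measure_eqI)
    fix A assume "A \<in> sets (distr R \<nu> (\<lambda>x. x))"
    then have A: "A \<in> sets \<nu>" by simp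
    have space: "space R = S"
      using sets.sets_into_space[OF S(1)] by (auto simp: R_def space_restrict_space)
    have "emeasure (distr R \<nu> (\<lambda>x. x)) A = emeasure R (A \<inter> S)"
      using A id by (simp add: emeasure_distr space)
    also have "\<dots> = emeasure \<nu> (A \<inter> S)"
      unfolding R_def by (rule emeasure_restrict_space) (use S sets.sets_into_space in auto)
    also have "\<dots> = emeasure \<nu> A"
    proof (rule emeasure_eq_AE)
      have "AE x in \<nu>. x \<in> S"
        using S emeasure_eq_1_AE prob_space_def by (simp add: AE_in_set_eq_1 emeasure_eq_measure)
      then show "AE x in \<nu>. x \<in> A \<inter> S \<longleftrightarrow> x \<in> A" by eventually_elim simp
    qed (use A S in auto)
    finally show "emeasure (distr R \<nu> (\<lambda>x. x)) A = emeasure \<nu> A" .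
  qed simp
  with PH_law_distr[OF R id \<nu>, where 'f = 'f]
  have "PH_law TYPE('f) q n dist \<nu> =
      distr (PiM {..<n} (\<lambda>_. R)) barcode_borel (\<lambda>\<omega>. PH TYPE('f) q n dist (\<lambda>i. \<omega> i))"
    by simp
  then show ?thesis by (simp add: PH_law_def R_def)
qed

lemma PH_law_coupled:
  fixes X Y :: "'w \<Rightarrow> 'm::{metric_space, second_countable_topology}"
  assumes M: "prob_space M" and X: "X \<in> borel_measurable M" and Y: "Y \<in> borel_measurable M"
    and c: "(\<integral>\<^sup>+w. ennreal (dist (X w) (Y w)) \<partial>M) \<le> ennreal c" "0 \<le> c"
    and \<epsilon>: "0 < \<epsilon>" "2 * real n * c \<le> \<epsilon>\<^sup>2"
    and A: "A \<in> sets barcode_borel"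
  shows "emeasure (PH_law TYPE('f::field) q n dist (distr M borel X)) A
    \<le> emeasure (PH_law TYPE('f) q n dist (distr M borel Y))
         {C \<in> barcodes. \<exists>B\<in>A. bottleneck B C < ennreal \<epsilon>} + ennreal \<epsilon>"
proof -
  interpret prob_space M by fact
  define Mn where "Mn = PiM {..<n} (\<lambda>_. M)"
  define A' where "A' = {C \<in> barcodes. \<exists>B\<in>A. bottleneck B C < ennreal \<epsilon>}"
  define phX where "phX = (\<lambda>\<omega> :: nat \<Rightarrow> 'w. PH TYPE('f) q n dist (\<lambda>i. X (\<omega> i)))"
  define phY where "phY = (\<lambda>\<omega> :: nat \<Rightarrow> 'w. PH TYPE('f) q n dist (\<lambda>i. Y (\<omega> i)))"
  have meas: "phX \<in> Mn \<rightarrow>\<^sub>M barcode_borel" "phY \<in> Mn \<rightarrow>\<^sub>M barcode_borel"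
    unfolding phX_def phY_def Mn_def using X Y by (intro measurable_PH_map; simp)+
  have A': "A' \<in> sets barcode_borel"
    unfolding A'_def by (rule barcode_neighbourhood_measurable)
  \<comment> \<open>The two points are at distance at least \<epsilon> / 2, written in the form in
    which Markov's inequality is applied.\<close>
  define far where "far = {w \<in> space M. 1 \<le> ennreal (2 / \<epsilon>) * ennreal (dist (X w) (Y w))}"
  have far_meas: "far \<in> sets M"
    unfolding far_def using X Y by measurable
  define N where "N = (\<lambda>i. {\<omega> \<in> space Mn. \<omega> i \<in> far})"
  have N_eq: "N i = (\<lambda>\<omega>. \<omega> i) -` far \<inter> space Mn" for i
    by (auto simp: N_def)
  have comp: "(\<lambda>\<omega>. \<omega> i) \<in> Mn \<rightarrow>\<^sub>M M" if "i < n" for i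
    unfolding Mn_def using that by (intro measurable_component_singleton) simp
  have N_meas: "N i \<in> sets Mn" if "i < n" for i
    unfolding N_eq by (rule measurable_sets[OF comp[OF that] far_meas])
  have N_emeasure: "emeasure Mn (N i) \<le> ennreal (2 / \<epsilon> * c)" if "i < n" for i
  proof -
    have "emeasure Mn (N i) = emeasure (distr Mn M (\<lambda>\<omega>. \<omega> i)) far"
      unfolding N_eq by (rule emeasure_distr[OF comp[OF that] far_meas, symmetric])
    also have "distr Mn M (\<lambda>\<omega>. \<omega> i) = M"
      unfolding Mn_def using distr_PiM_component[of "{..<n}" "\<lambda>_. M" i] M that by simp
    also have "emeasure M far \<le>
        ennreal (2 / \<epsilon>) * (\<integral>\<^sup>+w. ennreal (dist (X w) (Y w)) * indicator (space M) w \<partial>M)"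
      unfolding far_def by (rule nn_integral_Markov_inequality) (use X Y in measurable)
    also have "(\<integral>\<^sup>+w. ennreal (dist (X w) (Y w)) * indicator (space M) w \<partial>M) =
        (\<integral>\<^sup>+w. ennreal (dist (X w) (Y w)) \<partial>M)"
      by (intro nn_integral_cong) simp
    also have "ennreal (2 / \<epsilon>) * \<dots> \<le> ennreal (2 / \<epsilon>) * ennreal c"
      by (intro mult_left_mono c) simp
    also have "\<dots> = ennreal (2 / \<epsilon> * c)"
      by (rule ennreal_mult[symmetric]) (use \<epsilon>(1) c(2) in auto)
    finally show ?thesis .
  qed
  have sub: "phX -` A \<inter> space Mn \<subseteq> (phY -` A' \<inter> space Mn) \<union> (\<Union>i<n. N i)"
  proof
    fix \<omega> assume \<omega>: "\<omega> \<in> phX -` A \<inter> space Mn"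
    show "\<omega> \<in> (phY -` A' \<inter> space Mn) \<union> (\<Union>i<n. N i)"
    proof (cases "\<omega> \<in> (\<Union>i<n. N i)")
      case False
      \<comment> \<open>The largest displacement is strictly below \<epsilon> / 2, as the strict
        inequality in the neighbourhood demands. Inserting 0 covers \<open>n = 0\<close>.\<close>
      define \<delta> where "\<delta> = Max (insert 0 ((\<lambda>i. dist (X (\<omega> i)) (Y (\<omega> i))) ` {..<n}))"
      have "dist (X (\<omega> i)) (Y (\<omega> i)) < \<epsilon> / 2" if "i < n" for i
      proof -
        have "\<omega> i \<in> space M"
          using \<omega> that by (auto simp: Mn_def space_PiM)
        moreover have "\<omega> i \<notin> far"
          using False \<omega> that by (auto simp: N_def)
        ultimately have "\<not> 1 \<le> ennreal (2 / \<epsilon>) * ennreal (dist (X (\<omega> i)) (Y (\<omega> i)))"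
          by (simp add: far_def)
        then have "2 / \<epsilon> * dist (X (\<omega> i)) (Y (\<omega> i)) < 1"
          using \<epsilon>(1) by (simp add: ennreal_mult[symmetric] not_le)
        then show ?thesis using \<epsilon>(1) by (simp add: field_simps)
      qed
      then have "\<delta> < \<epsilon> / 2"
        unfolding \<delta>_def using \<epsilon>(1) by (subst Max_less_iff) auto
      moreover have \<delta>: "0 \<le> \<delta>" "\<And>i. i < n \<Longrightarrow> dist (X (\<omega> i)) (Y (\<omega> i)) \<le> \<delta>"
        unfolding \<delta>_def by simp_all
      moreover have "near_barcodes (2 * \<delta>) (phX \<omega>) (phY \<omega>)"
        unfolding phX_def phY_def by (rule PH_stable) (use \<delta> in auto)
      ultimately have "bottleneck (phX \<omega>) (phY \<omega>) < ennreal \<epsilon>"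
        unfolding bottleneck_less_iff by (intro exI[of _ "2 * \<delta>"]) auto
      moreover have "phY \<omega> \<in> barcodes"
        unfolding phY_def by (rule PH_in_barcodes)
      ultimately show ?thesis
        using \<omega> by (auto simp: A'_def)
    qed simp
  qed
  have laws: "PH_law TYPE('f) q n dist (distr M borel X) = distr Mn barcode_borel phX"
      "PH_law TYPE('f) q n dist (distr M borel Y) = distr Mn barcode_borel phY"
    unfolding Mn_def phX_def phY_def using PH_law_distr[OF M X refl] PH_law_distr[OF M Y refl] by blast+
  have "emeasure (distr Mn barcode_borel phX) A = emeasure Mn (phX -` A \<inter> space Mn)"
    by (rule emeasure_distr[OF meas(1) A])
  also have "\<dots> \<le> emeasure Mn ((phY -` A' \<inter> space Mn) \<union> (\<Union>i<n. N i))"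
    using N_meas measurable_sets[OF meas(2) A'] by (intro emeasure_mono sub) auto
  also have "\<dots> \<le> emeasure Mn (phY -` A' \<inter> space Mn) + emeasure Mn (\<Union>i<n. N i)"
    using N_meas measurable_sets[OF meas(2) A'] by (intro emeasure_subadditive) auto
  also have "emeasure Mn (\<Union>i<n. N i) \<le> (\<Sum>i<n. emeasure Mn (N i))"
    using N_meas by (intro emeasure_subadditive_finite) auto
  also have "\<dots> \<le> (\<Sum>i<n. ennreal (2 / \<epsilon> * c))"
    by (intro sum_mono N_emeasure) simp
  also have "\<dots> = ennreal (real n * (2 / \<epsilon> * c))"
    using \<epsilon>(1) c(2) by (subst sum_ennreal) simp_all
  \<comment> \<open>This is the assumption on \<open>2 * real n * c\<close>, divided by
    \<epsilon>.\<close>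
  also have "\<dots> \<le> ennreal \<epsilon>"
    using \<epsilon> by (intro ennreal_leI) (simp add: field_simps power2_eq_square)
  also have "emeasure Mn (phY -` A' \<inter> space Mn) = emeasure (distr Mn barcode_borel phY) A'"
    by (rule emeasure_distr[OF meas(2) A', symmetric])
  finally show ?thesis
    unfolding laws A'_def by (simp add: add_left_mono)
qed

section \<open>From couplings to the Prokhorov distance\<close>

lemma prokhorov_leI:
  assumes "0 < \<epsilon>"
    and "\<And>A. A \<in> sets \<mu> \<Longrightarrow>
      emeasure \<mu> A \<le> emeasure \<nu> {y \<in> space \<mu>. \<exists>x\<in>A. d x y < ennreal \<epsilon>} + ennreal \<epsilon>"
    and "\<And>A. A \<in> sets \<mu> \<Longrightarrow>
      emeasure \<nu> A \<le> emeasure \<mu> {y \<in> space \<mu>. \<exists>x\<in>A. d x y < ennreal \<epsilon>} + ennreal \<epsilon>"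
  shows "prokhorov d \<mu> \<nu> \<le> \<epsilon>"
  unfolding prokhorov_def Let_def
proof (rule cInf_lower)
  show "bdd_below {\<epsilon>. 0 < \<epsilon> \<and> (\<forall>A\<in>sets \<mu>.
     emeasure \<mu> A \<le> emeasure \<nu> {y \<in> space \<mu>. \<exists>x\<in>A. d x y < ennreal \<epsilon>} + ennreal \<epsilon> \<and>
     emeasure \<nu> A \<le> emeasure \<mu> {y \<in> space \<mu>. \<exists>x\<in>A. d x y < ennreal \<epsilon>} + ennreal \<epsilon>)}"
    by (rule bdd_belowI[of _ 0]) auto
qed (use assms in blast)

text \<open>On a bounded space this coupling has finite cost, which is how the infimum over
  couplings is seen to be finite.\<close>

lemma product_coupling:
  assumes "prob_space \<mu>" "prob_space \<nu>"
  shows "\<mu> \<Otimes>\<^sub>M \<nu> \<in> couplings \<mu> \<nu>"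
proof -
  interpret \<mu>: prob_space \<mu> by fact
  interpret \<nu>: prob_space \<nu> by fact
  have "distr (\<mu> \<Otimes>\<^sub>M \<nu>) \<nu> snd = \<nu>"
  proof (rule measure_eqI)
    fix A assume "A \<in> sets (distr (\<mu> \<Otimes>\<^sub>M \<nu>) \<nu> snd)"
    then have A: "A \<in> sets \<nu>" by simp
    have "snd -` A \<inter> space (\<mu> \<Otimes>\<^sub>M \<nu>) = space \<mu> \<times> A"
      using sets.sets_into_space[OF A] by (auto simp: space_pair_measure)
    then show "emeasure (distr (\<mu> \<Otimes>\<^sub>M \<nu>) \<nu> snd) A = emeasure \<nu> A"
      using A by (simp add: emeasure_distr \<nu>.emeasure_pair_measure_Times \<mu>.emeasure_space_1)
  qed simp
  then show ?thesis
    by (simp add: couplings_def \<nu>.distr_pair_fst)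
qed

theorem prokhorov_PH_law_le:
  fixes \<mu> \<nu> :: "'m::{metric_space, second_countable_topology} measure"
  assumes \<mu>: "prob_space \<mu>" "sets \<mu> = sets borel" and \<nu>: "prob_space \<nu>" "sets \<nu> = sets borel"
    and bounded: "bounded (UNIV :: 'm set)" and "0 < n"
  shows "prokhorov bottleneck (PH_law TYPE('f::field) q n dist \<mu>) (PH_law TYPE('f) q n dist \<nu>)
    \<le> sqrt (2 * real n * wasserstein1 dist \<mu> \<nu>)"
proof (rule dense_ge)
  define I where "I = (INF \<pi>\<in>couplings \<mu> \<nu>. \<integral>\<^sup>+z. ennreal (dist (fst z) (snd z)) \<partial>\<pi>)"
  define W where "W = wasserstein1 dist \<mu> \<nu>"
  have prob: "prob_space \<pi>" if "\<pi> \<in> couplings \<mu> \<nu>" for \<pi>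
  proof (rule prob_space_distrD)
    show "fst \<in> \<pi> \<rightarrow>\<^sub>M \<mu>"
      using that measurable_fst measurable_cong_sets[of \<pi> "\<mu> \<Otimes>\<^sub>M \<nu>" \<mu> \<mu>]
      by (auto simp: couplings_def)
    show "prob_space (distr \<pi> \<mu> fst)"
      using that \<mu>(1) by (simp add: couplings_def)
  qed
  \<comment> \<open>An infinite infimum would be turned into 0 by \<open>enn2real\<close>, and
    \<open>I = ennreal W\<close> would fail.\<close>
  have "I < top_class.top"
  proof -
    have "I \<le> (\<integral>\<^sup>+z. ennreal (dist (fst z) (snd z)) \<partial>(\<mu> \<Otimes>\<^sub>M \<nu>))"
      unfolding I_def by (rule INF_lower[OF product_coupling[OF \<mu>(1) \<nu>(1)]])
    also have "\<dots> \<le> (\<integral>\<^sup>+z. ennreal (diameter (UNIV :: 'm set)) \<partial>(\<mu> \<Otimes>\<^sub>M \<nu>))"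
      using diameter_bounded_bound[OF bounded] by (intro nn_integral_mono ennreal_leI) simp
    also have "\<dots> = ennreal (diameter (UNIV :: 'm set))"
      using prob_space.emeasure_space_1[OF prob[OF product_coupling[OF \<mu>(1) \<nu>(1)]]] by simp
    finally show ?thesis
      using ennreal_less_top le_less_trans by blast
  qed
  then have I_W: "I = ennreal W"
    by (simp add: W_def wasserstein1_def I_def)
  have W: "0 \<le> W" by (simp add: W_def wasserstein1_def)
  \<comment> \<open>An arbitrary \<epsilon> above the bound leaves room for a coupling whose cost
    merely approaches the infimum.\<close>
  fix \<epsilon> assume "sqrt (2 * real n * wasserstein1 dist \<mu> \<nu>) < \<epsilon>"
  then have less: "sqrt (2 * real n * W) < \<epsilon>" by (simp add: W_def)
  then have \<epsilon>: "0 < \<epsilon>"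
    using W by (intro le_less_trans[OF real_sqrt_ge_zero]) auto
  \<comment> \<open>The largest cost that \<open>PH_law_coupled\<close> admits for this
    \<epsilon>.\<close>
  define c where "c = \<epsilon>\<^sup>2 / (2 * real n)"
  have "2 * real n * W < \<epsilon>\<^sup>2"
    using less \<epsilon> real_sqrt_less_iff[of "2 * real n * W" "\<epsilon>\<^sup>2"] by simp
  then have "W < c"
    using \<open>0 < n\<close> by (simp add: c_def field_simps)
  then have "I < ennreal c"
    unfolding I_W using W by (simp add: ennreal_lessI)
  then obtain \<pi> where \<pi>: "\<pi> \<in> couplings \<mu> \<nu>"
      "(\<integral>\<^sup>+z. ennreal (dist (fst z) (snd z)) \<partial>\<pi>) < ennreal c"
    unfolding I_def INF_less_iff by blast
  have sets: "sets \<pi> = sets (\<mu> \<Otimes>\<^sub>M \<nu>)" "distr \<pi> \<mu> fst = \<mu>" "distr \<pi> \<nu> snd = \<nu>"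
    using \<pi>(1) by (simp_all add: couplings_def)
  have sets': "sets \<pi> = sets (borel \<Otimes>\<^sub>M borel)"
    unfolding sets(1) by (rule sets_pair_measure_cong[OF \<mu>(2) \<nu>(2)])
  have meas: "fst \<in> borel_measurable \<pi>" "snd \<in> borel_measurable \<pi>"
    using measurable_cong_sets[OF sets' refl] measurable_fst measurable_snd by blast+
  have marg: "distr \<pi> borel fst = \<mu>" "distr \<pi> borel snd = \<nu>"
    using sets(2,3) distr_cong[of \<pi> \<pi> borel \<mu> fst fst] distr_cong[of \<pi> \<pi> borel \<nu> snd snd] \<mu>(2) \<nu>(2)
    by simp_all
  have c: "0 \<le> c" "2 * real n * c \<le> \<epsilon>\<^sup>2"
    using \<open>0 < n\<close> by (simp_all add: c_def)
  have c': "(\<integral>\<^sup>+z. ennreal (dist (fst z) (snd z)) \<partial>\<pi>) \<le> ennreal c"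
      "(\<integral>\<^sup>+z. ennreal (dist (snd z) (fst z)) \<partial>\<pi>) \<le> ennreal c"
    using \<pi>(2) by (simp_all add: dist_commute less_imp_le)
  \<comment> \<open>The Prokhorov condition is two-sided; the second instance exchanges the two
    projections of the coupling.\<close>
  note coupled = PH_law_coupled[OF prob[OF \<pi>(1)] meas c'(1) c(1) \<epsilon> c(2), unfolded marg, where 'f = 'f]
    PH_law_coupled[OF prob[OF \<pi>(1)] meas(2,1) c'(2) c(1) \<epsilon> c(2), unfolded marg, where 'f = 'f]
  show "prokhorov bottleneck (PH_law TYPE('f) q n dist \<mu>) (PH_law TYPE('f) q n dist \<nu>) \<le> \<epsilon>"
    by (rule prokhorov_leI[OF \<epsilon>]) (unfold space_PH_law sets_PH_law, (rule coupled, assumption)+)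
qed

section \<open>The orbit measure and the final estimate\<close>

lemma word_mset_nonempty: "T \<noteq> {#} \<Longrightarrow> word_mset K T l \<noteq> {#}"
proof (induction l)
  case (Suc l)
  obtain s T' where "T = add_mset s T'"
    using \<open>T \<noteq> {#}\<close> by (cases T) auto
  then show ?case using Suc by simp
qed simp

text \<open>Multiplicities are kept, so an element of \<open>S\<close> that is also an inverse
  counts twice.\<close>

lemma size_sym_mset: "size (sym_mset K S) = 2 * card S"
  by (simp add: sym_mset_def)

lemma empirical_measure_support:
  fixes P :: "'m::t1_space multiset"
  assumes "P \<noteq> {#}"
  shows "prob_space (empirical_measure P)" "sets (empirical_measure P) = sets borel"
    "set_mset P \<in> sets (empirical_measure P)" "emeasure (empirical_measure P) (set_mset P) = 1"
proof -
  show "prob_space (empirical_measure P)"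
    unfolding empirical_measure_def by (rule prob_space.prob_space_distr[OF prob_space_measure_pmf]) simp
  show "sets (empirical_measure P) = sets borel"
    by (simp add: empirical_measure_def)
  have borel: "set_mset P \<in> sets borel"
    by (intro borel_closed finite_imp_closed) simp
  then show "set_mset P \<in> sets (empirical_measure P)"
    by (simp add: empirical_measure_def)
  show "emeasure (empirical_measure P) (set_mset P) = 1"
    using borel emeasure_pmf[of "pmf_of_multiset P"] set_pmf_of_multiset[OF assms]
    by (simp add: empirical_measure_def emeasure_distr)
qed

theorem theorem4p68:
  fixes K :: "'g::{t2_space, second_countable_topology} monoid"
    and AK :: "('g, 'e::real_normed_vector) chart set"
    and H :: "'g set"
    and AM :: "('m::{metric_space, second_countable_topology}, 'v::real_normed_vector) chart set"
    and g :: "('m, 'v) metric_field"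
    and act :: "'g \<Rightarrow> 'm \<Rightarrow> 'm"
    and o\<^sub>M p\<^sub>0 :: 'm
    and \<sigma> \<sigma>\<^sub>l :: "'m measure"
    and S :: "'g set"
    and P :: "'m multiset"
    and l q n :: nat
  assumes "semisimple_lie_group K AK"
    and "compact (UNIV :: 'g set)" and "connected (UNIV :: 'g set)"
    and "riemannian_symmetric_space AM g"
    and "compact (UNIV :: 'm set)" and "connected (UNIV :: 'm set)"
    and "\<forall>x y. ennreal (dist x y) = riemannian_distance AM g x y"
    and "transitive_action K UNIV act"
    and "smooth_map (prod_atlas AK AM) AM (\<lambda>(s, x). act s x)"
    and "\<forall>s. riemannian_isometry AM g (act s)"
    and "subgroup H K" and "closed H" and "stabilizer K act o\<^sub>M = H"
    and "prob_space \<sigma>" and "sets \<sigma> = sets borel" and "\<forall>s. distr \<sigma> borel (act s) = \<sigma>"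
    and "finite S" and "S \<noteq> {}" and "S \<subseteq> carrier K"
    and "1 \<le> l"
    and "n = size (sym_mset K S) ^ l"
    and "P = image_mset (\<lambda>s. act s p\<^sub>0) (word_mset K (sym_mset K S) l)"
    and "\<sigma>\<^sub>l = empirical_measure P"
  shows "1 / real n *
           prokhorov bottleneck
             (PH_law TYPE('f::field) q n dist \<sigma>)
             (PH_law TYPE('f) q n dist (restrict_space \<sigma>\<^sub>l (set_mset P)))
         \<le> sqrt (wasserstein1 dist \<sigma> \<sigma>\<^sub>l)"
proof -
  define W where "W = wasserstein1 dist \<sigma> \<sigma>\<^sub>l"
  have size: "2 \<le> size (sym_mset K S)"
    using assms(17,18) by (simp add: size_sym_mset card_gt_0_iff Suc_le_eq)
  have "size (sym_mset K S) ^ 1 \<le> size (sym_mset K S) ^ l"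
    using size assms(20) by (intro power_increasing) auto
  then have n: "2 \<le> n"
    using size assms(21) by simp
  have "sym_mset K S \<noteq> {#}"
    using size by auto
  then have "P \<noteq> {#}"
    using word_mset_nonempty assms(22) by simp
  note \<sigma>\<^sub>l = empirical_measure_support[OF this, folded assms(23)]
  have "prokhorov bottleneck (PH_law TYPE('f) q n dist \<sigma>) (PH_law TYPE('f) q n dist \<sigma>\<^sub>l)
      \<le> sqrt (2 * real n * W)"
    unfolding W_def
    by (rule prokhorov_PH_law_le[OF assms(14,15) \<sigma>\<^sub>l(1,2) compact_imp_bounded[OF assms(5)]])
      (use n in simp)
  also have "\<dots> \<le> sqrt ((real n)\<^sup>2 * W)"
  proof (intro real_sqrt_le_mono mult_right_mono)
    show "2 * real n \<le> (real n)\<^sup>2"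
      using n by (simp add: power2_eq_square)
    show "0 \<le> W"
      by (simp add: W_def wasserstein1_def)
  qed
  also have "\<dots> = real n * sqrt W"
    by (simp add: real_sqrt_mult)
  \<comment> \<open>The second law samples from the finite orbit; as the orbit has full measure,
    this is the law of \<open>\<sigma>\<^sub>l\<close> on the whole space.\<close>
  finally show ?thesis
    unfolding PH_law_restrict_space[OF \<sigma>\<^sub>l] W_def using n by (simp add: field_simps)
qed

end
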